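(* Let $\mathsf{V}=(\mathsf{V},\otimes,k)$ be a commutative quantale, let $X,Y,Z$ be complete $\mathsf{V}$-categories, and let $(X,Y,Z,\circledast,\swarrow,\searrow)$ be a two-variable adjunction in $\mathsf{V}\text{-}\mathbf{Cat}$. Let $A,B$ be $\mathsf{V}$-categories and let $\psi\colon A^{\mathrm{op}}\otimes B\to Y$ be a $\mathsf{V}$-bifunctor. Then a $\mathsf{V}$-category $C$ is equivalent to $\mathsf{K}\psi$ if, and only if, $C$ is complete and there exist a dense $\mathsf{V}$-bifunctor $\beta\colon B\otimes X\to C$ and a codense $\mathsf{V}$-bifunctor $\alpha\colon A\otimes Z\to C$ such that $$C(\beta(b,x),\alpha(a,z))=Y(\psi(a,b),x\searrow z)$$ for all $a\in A$, $b\in B$, $x\in X$, $z\in Z$.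
   Context: A commutative quantale is a commutative monoid $(\mathsf{V},\otimes,k)$ whose underlying set is a complete lattice with $x\otimes\bigvee_i y_i=\bigvee_i x\otimes y_i$; the implication $\to$ is defined by $x\otimes y\leq z\iff x\leq y\to z$. A $\mathsf{V}$-category is a set $X$ with a map $X(-,-)\colon X\times X\to\mathsf{V}$ such that $k\leq X(x,x)$ and $X(x,y)\otimes X(y,z)\leq X(x,z)$. Its underlying preorder is $x\leq y\iff k\leq X(x,y)$; $x\cong y$ means $x\leq y$ and $y\leq x$. A $\mathsf{V}$-functor $f\colon X\to Y$ is a map with $X(x,y)\leq Y(fx,fy)$; $\mathsf{V}$-functors are ordered pointwise ($f\leq g$ iff $fx\leq gx$ for all $x$). Two $\mathsf{V}$-categories $X,Y$ are equivalent if there are $\mathsf{V}$-functors $f\colon X\to Y$, $g\colon Y\to X$ with $gf\cong 1_X$ and $fg\cong 1_Y$. $\mathsf{V}$ is a $\mathsf{V}$-category via $\mathsf{V}(x,y)=x\to y$. $X^{\mathrm{op}}$ has the same objects with $X^{\mathrm{op}}(x,y)=X(y,x)$. $X\otimes Y$ has object set $X\times Y$ and $(X\otimes Y)((x,y),(x',y'))=X(x,x')\otimes Y(y,y')$. $Y^X$ is the $\mathsf{V}$-category of $\mathsf{V}$-functors $X\to Y$ with $Y^X(f,g)=\bigwedge_{x\in X}Y(fx,gx)$. A $\mathsf{V}$-bifunctor is a $\mathsf{V}$-functor $X\otimes Y\to Z$. A two-variable adjunction $(X,Y,Z,\circledast,\swarrow,\searrow)$ in $\mathsf{V}\text{-}\mathbf{Cat}$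 consists of $\mathsf{V}$-bifunctors $\circledast\colon X\otimes Y\to Z$, $\swarrow\colon Z\otimes Y^{\mathrm{op}}\to X$, $\searrow\colon X^{\mathrm{op}}\otimes Z\to Y$ such that $Z(x\circledast y,z)=X(x,z\swarrow y)=Y(y,x\searrow z)$ for all $x\in X$, $y\in Y$, $z\in Z$. A supremum of $\mu\in\mathsf{V}^{X^{\mathrm{op}}}$ is an object $\sup\mu\in X$ with $X(\sup\mu,x)=\bigwedge_{y\in X}\mu y\to X(y,x)$ for all $x\in X$; an infimum of $\lambda\in\mathsf{V}^X$ is an object $\inf\lambda\in X$ with $X(x,\inf\lambda)=\bigwedge_{y\in X}\lambda y\to X(x,y)$ for all $x\in X$. $X$ is complete if every $\lambda\in\mathsf{V}^X$ has an infimum; equivalently every $\mu\in\mathsf{V}^{X^{\mathrm{op}}}$ has a supremum. In a complete $\mathsf{V}$-category all joins and meets exist in the underlying preorder (determined up to $\cong$; $\bigvee,\bigwedge$ denote chosen ones), and $X(x,\bigwedge_i y_i)=\bigwedge_i X(x,y_i)$, $X(\bigvee_i y_i,x)=\bigwedge_i X(y_i,x)$. A $\mathsf{V}$-functor $f\colon X\to Y$ is dense if for every $y\in Y$ there is $\mu\in\mathsf{V}^{X^{\mathrm{op}}}$ such that $y$ is a supremum of the presheaf $y'\mapsto\bigvee_{x\in X}Y(y',fx)\otimes\mu x$ on $Y$; it is codense if for every $y\in Y$ there is $\lambda\in\mathsf{V}^X$ such that $y$ is an infimum of the copresheaf $y'\mapsto\bigvee_{x\in X}Y(fx,y')\otimes\lambda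 x$ on $Y$. For $\psi\colon A^{\mathrm{op}}\otimes B\to Y$ define $\mathsf{V}$-functors $$\psi^*\colon X^{B^{\mathrm{op}}}\to Z^{A^{\mathrm{op}}},\ (\psi^*\lambda)a=\bigvee_{b\in B}\lambda b\circledast\psi(a,b),\qquad \psi_*\colon Z^{A^{\mathrm{op}}}\to X^{B^{\mathrm{op}}},\ (\psi_*\mu)b=\bigwedge_{a\in A}\mu a\swarrow\psi(a,b),$$ with joins and meets taken in the underlying preorders of $Z$ and $X$. Then $\mathsf{K}\psi:=\{\lambda\in X^{B^{\mathrm{op}}}\mid\psi_*\psi^*\lambda\cong\lambda\}$, a $\mathsf{V}$-category with the hom inherited from $X^{B^{\mathrm{op}}}$. *)

theory Defs
  imports Main "HOL-Library.FuncSet"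
begin

text \<open>The tensor of the quantale is multiplication and its unit \<open>k\<close> is \<open>1\<close>.\<close>

class comm_quantale = complete_lattice + comm_monoid_mult +
  assumes mult_Sup_distrib: "x * Sup Y = Sup ((\<lambda>y. x * y) ` Y)"

definition quantale_imp :: "'v::comm_quantale \<Rightarrow> 'v \<Rightarrow> 'v" (infixr "\<leadsto>" 60)
  where "y \<leadsto> z = Sup {x. x * y \<le> z}"

lemma quantale_mult_mono:
  fixes x :: "'v::comm_quantale"
  assumes "y \<le> z"
  shows "x * y \<le> x * z"
proof -
  have "x * z = x * Sup {y, z}"
    using assms by (simp add: sup_absorb2)
  also have "\<dots> = sup (x * y) (x * z)"
    using mult_Sup_distrib[of x "{y, z}"] by simp
  finally show ?thesis
    by (metis sup_ge1)
qed

lemma quantale_residuation: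
  fixes x :: "'v::comm_quantale"
  shows "x * y \<le> z \<longleftrightarrow> x \<le> y \<leadsto> z"
proof
  assume "x * y \<le> z"
  then show "x \<le> y \<leadsto> z"
    unfolding quantale_imp_def by (auto intro: Sup_upper)
next
  assume "x \<le> y \<leadsto> z"
  then have "y * x \<le> y * (y \<leadsto> z)"
    by (rule quantale_mult_mono)
  also have "\<dots> = Sup ((\<lambda>x. y * x) ` {x. x * y \<le> z})"
    by (simp add: quantale_imp_def mult_Sup_distrib)
  also have "\<dots> \<le> z"
    by (auto intro!: Sup_least simp: mult.commute)
  finally show "x * y \<le> z"
    by (simp add: mult.commute)
qed

text \<open>Objects form a set rather than a type, so that a category may be empty; the values of
  \<open>hom\<close> outside \<open>obj\<close> are irrelevant.\<close>

record ('a, 'v) vcat =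
  obj :: "'a set"
  hom :: "'a \<Rightarrow> 'a \<Rightarrow> 'v"

definition vcategory :: "('a, 'v::comm_quantale) vcat \<Rightarrow> bool"
  where "vcategory X \<longleftrightarrow>
    (\<forall>x\<in>obj X. 1 \<le> hom X x x) \<and>
    (\<forall>x\<in>obj X. \<forall>y\<in>obj X. \<forall>z\<in>obj X. hom X x y * hom X y z \<le> hom X x z)"

definition vle :: "('a, 'v::comm_quantale) vcat \<Rightarrow> 'a \<Rightarrow> 'a \<Rightarrow> bool"
  where "vle X x y \<longleftrightarrow> 1 \<le> hom X x y"

definition viso :: "('a, 'v::comm_quantale) vcat \<Rightarrow> 'a \<Rightarrow> 'a \<Rightarrow> bool"
  where "viso X x y \<longleftrightarrow> vle X x y \<and> vle X y x"

definition vfunctor ::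
    "('a, 'v::comm_quantale) vcat \<Rightarrow> ('b, 'v) vcat \<Rightarrow> ('a \<Rightarrow> 'b) \<Rightarrow> bool"
  where "vfunctor X Y f \<longleftrightarrow>
    f \<in> obj X \<rightarrow> obj Y \<and>
    (\<forall>x\<in>obj X. \<forall>y\<in>obj X. hom X x y \<le> hom Y (f x) (f y))"

definition vequivalent :: "('a, 'v::comm_quantale) vcat \<Rightarrow> ('b, 'v) vcat \<Rightarrow> bool"
  where "vequivalent X Y \<longleftrightarrow>
    (\<exists>f g. vfunctor X Y f \<and> vfunctor Y X g \<and>
      (\<forall>x\<in>obj X. viso X (g (f x)) x) \<and> (\<forall>y\<in>obj Y. viso Y (f (g y)) y))"

definition vself :: "('v::comm_quantale, 'v) vcat"
  where "vself = \<lparr>obj = UNIV, hom = (\<leadsto>)\<rparr>"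

definition vop :: "('a, 'v::comm_quantale) vcat \<Rightarrow> ('a, 'v) vcat"
  where "vop X = \<lparr>obj = obj X, hom = (\<lambda>x y. hom X y x)\<rparr>"

definition vtensor ::
    "('a, 'v::comm_quantale) vcat \<Rightarrow> ('b, 'v) vcat \<Rightarrow> ('a \<times> 'b, 'v) vcat" (infixr "\<otimes>\<^sub>V" 75)
  where "X \<otimes>\<^sub>V Y =
    \<lparr>obj = obj X \<times> obj Y, hom = (\<lambda>(x, y) (x', y'). hom X x x' * hom Y y y')\<rparr>"

text \<open>\<open>vfun X Y\<close> is the functor category \<open>Y\<^sup>X\<close>. Its objects are extensional functions, so that
  they correspond exactly to the functors defined on the object set of \<open>X\<close>.\<close>

definition vfun ::
    "('a, 'v::comm_quantale) vcat \<Rightarrow> ('b, 'v) vcat \<Rightarrow> ('a \<Rightarrow> 'b, 'v) vcat"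
  where "vfun X Y =
    \<lparr>obj = {f \<in> extensional (obj X). vfunctor X Y f},
     hom = (\<lambda>f g. INF x\<in>obj X. hom Y (f x) (g x))\<rparr>"

abbreviation presheaves :: "('a, 'v::comm_quantale) vcat \<Rightarrow> ('a \<Rightarrow> 'v) set"
  where "presheaves X \<equiv> obj (vfun (vop X) vself)"

abbreviation copresheaves :: "('a, 'v::comm_quantale) vcat \<Rightarrow> ('a \<Rightarrow> 'v) set"
  where "copresheaves X \<equiv> obj (vfun X vself)"

definition is_vsup :: "('a, 'v::comm_quantale) vcat \<Rightarrow> ('a \<Rightarrow> 'v) \<Rightarrow> 'a \<Rightarrow> bool"
  where "is_vsup X \<mu> s \<longleftrightarrow>
    s \<in> obj X \<and> (\<forall>x\<in>obj X. hom X s x = (INF y\<in>obj X. \<mu> y \<leadsto> hom X y x))"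

definition is_vinf :: "('a, 'v::comm_quantale) vcat \<Rightarrow> ('a \<Rightarrow> 'v) \<Rightarrow> 'a \<Rightarrow> bool"
  where "is_vinf X \<nu> i \<longleftrightarrow>
    i \<in> obj X \<and> (\<forall>x\<in>obj X. hom X x i = (INF y\<in>obj X. \<nu> y \<leadsto> hom X x y))"

definition vcomplete :: "('a, 'v::comm_quantale) vcat \<Rightarrow> bool"
  where "vcomplete X \<longleftrightarrow> (\<forall>\<nu> \<in> copresheaves X. \<exists>i. is_vinf X \<nu> i)"

definition is_join :: "('a, 'v::comm_quantale) vcat \<Rightarrow> 'a set \<Rightarrow> 'a \<Rightarrow> bool"
  where "is_join X S j \<longleftrightarrow>
    j \<in> obj X \<and> (\<forall>s\<in>S. vle X s j) \<and>
    (\<forall>u\<in>obj X. (\<forall>s\<in>S. vle X s u) \<longrightarrow> vle X j u)"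

definition is_meet :: "('a, 'v::comm_quantale) vcat \<Rightarrow> 'a set \<Rightarrow> 'a \<Rightarrow> bool"
  where "is_meet X S m \<longleftrightarrow>
    m \<in> obj X \<and> (\<forall>s\<in>S. vle X m s) \<and>
    (\<forall>l\<in>obj X. (\<forall>s\<in>S. vle X l s) \<longrightarrow> vle X l m)"

text \<open>Chosen joins and meets in the underlying preorder; meaningful only where one exists.\<close>

definition vjoin :: "('a, 'v::comm_quantale) vcat \<Rightarrow> 'a set \<Rightarrow> 'a"
  where "vjoin X S = (SOME j. is_join X S j)"

definition vmeet :: "('a, 'v::comm_quantale) vcat \<Rightarrow> 'a set \<Rightarrow> 'a"
  where "vmeet X S = (SOME m. is_meet X S m)"

definition vdense ::
    "('a, 'v::comm_quantale) vcat \<Rightarrow> ('b, 'v) vcat \<Rightarrow> ('a \<Rightarrow> 'b) \<Rightarrow> bool"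
  where "vdense X Y f \<longleftrightarrow>
    vfunctor X Y f \<and>
    (\<forall>y\<in>obj Y. \<exists>\<mu> \<in> presheaves X.
      is_vsup Y (\<lambda>y'\<in>obj Y. SUP x\<in>obj X. hom Y y' (f x) * \<mu> x) y)"

definition vcodense ::
    "('a, 'v::comm_quantale) vcat \<Rightarrow> ('b, 'v) vcat \<Rightarrow> ('a \<Rightarrow> 'b) \<Rightarrow> bool"
  where "vcodense X Y f \<longleftrightarrow>
    vfunctor X Y f \<and>
    (\<forall>y\<in>obj Y. \<exists>\<nu> \<in> copresheaves X.
      is_vinf Y (\<lambda>y'\<in>obj Y. SUP x\<in>obj X. hom Y (f x) y' * \<nu> x) y)"

text \<open>In \<open>two_var_adjunction X Y Z t l r\<close> the three bifunctors are
  \<open>t (x, y) = x \<circledast> y\<close>, \<open>l (z, y) = z \<swarrow> y\<close> and \<open>r (x, z) = x \<searrow> z\<close>.\<close>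

definition two_var_adjunction ::
    "('x, 'v::comm_quantale) vcat \<Rightarrow> ('y, 'v) vcat \<Rightarrow> ('z, 'v) vcat \<Rightarrow>
     ('x \<times> 'y \<Rightarrow> 'z) \<Rightarrow> ('z \<times> 'y \<Rightarrow> 'x) \<Rightarrow> ('x \<times> 'z \<Rightarrow> 'y) \<Rightarrow> bool"
  where "two_var_adjunction X Y Z t l r \<longleftrightarrow>
    vfunctor (X \<otimes>\<^sub>V Y) Z t \<and>
    vfunctor (Z \<otimes>\<^sub>V vop Y) X l \<and>
    vfunctor (vop X \<otimes>\<^sub>V Z) Y r \<and>
    (\<forall>x\<in>obj X. \<forall>y\<in>obj Y. \<forall>z\<in>obj Z.
      hom Z (t (x, y)) z = hom X x (l (z, y)) \<and>
      hom X x (l (z, y)) = hom Y y (r (x, z)))"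

definition psi_upper ::
    "('x \<times> 'y \<Rightarrow> 'z) \<Rightarrow> ('z, 'v::comm_quantale) vcat \<Rightarrow> ('a, 'v) vcat \<Rightarrow> ('b, 'v) vcat \<Rightarrow>
     ('a \<times> 'b \<Rightarrow> 'y) \<Rightarrow> ('b \<Rightarrow> 'x) \<Rightarrow> 'a \<Rightarrow> 'z"
  where "psi_upper t Z A B \<psi> \<nu> =
    (\<lambda>a\<in>obj A. vjoin Z ((\<lambda>b. t (\<nu> b, \<psi> (a, b))) ` obj B))"

definition psi_lower ::
    "('z \<times> 'y \<Rightarrow> 'x) \<Rightarrow> ('x, 'v::comm_quantale) vcat \<Rightarrow> ('a, 'v) vcat \<Rightarrow> ('b, 'v) vcat \<Rightarrow>
     ('a \<times> 'b \<Rightarrow> 'y) \<Rightarrow> ('a \<Rightarrow> 'z) \<Rightarrow> 'b \<Rightarrow> 'x"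
  where "psi_lower l X A B \<psi> \<mu> =
    (\<lambda>b\<in>obj B. vmeet X ((\<lambda>a. l (\<mu> a, \<psi> (a, b))) ` obj A))"

definition K ::
    "('x \<times> 'y \<Rightarrow> 'z) \<Rightarrow> ('z \<times> 'y \<Rightarrow> 'x) \<Rightarrow> ('x, 'v::comm_quantale) vcat \<Rightarrow> ('z, 'v) vcat \<Rightarrow>
     ('a, 'v) vcat \<Rightarrow> ('b, 'v) vcat \<Rightarrow> ('a \<times> 'b \<Rightarrow> 'y) \<Rightarrow> ('b \<Rightarrow> 'x, 'v) vcat"
  where "K t l X Z A B \<psi> =
    \<lparr>obj = {\<nu> \<in> obj (vfun (vop B) X).
        viso (vfun (vop B) X) (psi_lower l X A B \<psi> (psi_upper t Z A B \<psi> \<nu>)) \<nu>},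
     hom = hom (vfun (vop B) X)\<rparr>"

end

theory Submission
  imports Defs
begin

text \<open>
  Write \<open>P = X\<^bsup>B\<^sup>o\<^sup>p\<^esup>\<close> and \<open>Q = Z\<^bsup>A\<^sup>o\<^sup>p\<^esup>\<close>, and let \<open>up = \<psi>\<^sup>*\<close> and \<open>lo = \<psi>\<^sub>*\<close>.  Computing homs pointwise
  gives an adjunction \<open>Q(up \<nu>, \<mu>) = P(\<nu>, lo \<mu>)\<close> (\<open>up_lo_adjoint\<close>), and \<open>K\<psi>\<close> consists of its fixed
  points in \<open>P\<close>, a reflective subcategory with reflector \<open>lo \<circ> up\<close> (\<open>K_reflection\<close>).  An
  equivalence \<open>C \<simeq> K\<psi>\<close> amounts to a fully faithful, essentially surjective map \<open>F\<close> from \<open>C\<close> to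
  \<open>K\<psi>\<close>.  Both directions rest on the idea that \<open>F\<close> and the bifunctors determine each other by the
  representations
    \<open>C(\<beta>(b, x), c) = X(x, F c b)\<close> and \<open>C(c, \<alpha>(a, z)) = Z(up (F c) a, z)\<close>.

  Given \<open>F\<close>, the first formula is solved by reflecting into \<open>K\<psi>\<close> the functor freely generated by \<open>x\<close>
  at \<open>b\<close>, and the second by applying \<open>lo\<close> to the functor cofreely generated by \<open>z\<close> at \<open>a\<close>.  By
  Yoneda, \<open>P(F c, F d)\<close> is then a meet over \<open>(b, x)\<close> of \<open>C(\<beta>(b, x), c) \<leadsto> C(\<beta>(b, x), d)\<close>.  Since
  density of \<open>\<beta>\<close> says that \<open>C(c, d)\<close> is this meet (\<open>vdense_iff_canonical\<close>), it follows from full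
  faithfulness.  Codensity of \<open>\<alpha>\<close> follows in the same way from \<open>Q(up (F c), up (F d)) = C(c, d)\<close>, and
  completeness of \<open>C\<close> from that of a reflective subcategory of \<open>P\<close>.

  Given \<open>\<beta>\<close> and \<open>\<alpha>\<close>, codensity exhibits \<open>c\<close> as a limit of objects \<open>\<alpha>(a, z)\<close>, for which
  \<open>C(\<beta>(b, x), \<alpha>(a, z)) = X(x, z \<swarrow> \<psi>(a, b))\<close>; so \<open>F c b\<close> exists as a weighted limit in \<open>X\<close>.  The
  density formulas turn into full faithfulness of \<open>F\<close>, into the second representation, and into
  \<open>lo (up (F c)) \<cong> F c\<close>.  Finally a fixed point \<open>\<nu>\<close> is isomorphic to \<open>F c\<close> for \<open>c\<close> the join of the
  \<open>\<beta>(b, \<nu> b)\<close>, because \<open>up \<nu>\<close> and \<open>up (F c)\<close> represent the same functors.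
\<close>

section \<open>Quantales and enriched categories\<close>

lemma quantale_mult_mono2:
  fixes x :: "'v::comm_quantale"
  assumes "x \<le> x'" "y \<le> y'"
  shows "x * y \<le> x' * y'"
  by (metis assms mult.commute order.trans quantale_mult_mono)

lemma quantale_imp_mp: "(x::'v::comm_quantale) * (x \<leadsto> z) \<le> z"
  by (metis mult.commute order_refl quantale_residuation)

lemma one_quantale_imp [simp]: "1 \<leadsto> (z::'v::comm_quantale) = z"
  by (rule order.antisym) (metis mult_1 quantale_imp_mp, metis mult_1_right order_refl quantale_residuation)

lemma quantale_imp_mono:
  fixes x :: "'v::comm_quantale"
  assumes "x' \<le> x" "z \<le> z'"
  shows "x \<leadsto> z \<le> x' \<leadsto> z'"
proof -
  have "(x \<leadsto> z) * x' \<le> x * (x \<leadsto> z)"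
    by (metis assms(1) mult.commute quantale_mult_mono)
  also have "\<dots> \<le> z'" using quantale_imp_mp assms(2) by (rule order.trans)
  finally show ?thesis by (simp add: quantale_residuation)
qed

lemma quantale_imp_mult:
  fixes x :: "'v::comm_quantale"
  shows "(x * y) \<leadsto> z = x \<leadsto> (y \<leadsto> z)"
proof -
  have "w \<le> (x * y) \<leadsto> z \<longleftrightarrow> w \<le> x \<leadsto> (y \<leadsto> z)" for w
    by (simp add: quantale_residuation[symmetric] mult.assoc)
  then show ?thesis by (meson order.antisym order_refl)
qed

lemma quantale_imp_INF:
  fixes x :: "'v::comm_quantale"
  shows "x \<leadsto> (INF i\<in>I. f i) = (INF i\<in>I. x \<leadsto> f i)"
proof -
  have "w \<le> x \<leadsto> (INF i\<in>I. f i) \<longleftrightarrow> w \<le> (INF i\<in>I. x \<leadsto> f i)" for w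
    by (simp add: quantale_residuation[symmetric] le_INF_iff)
  then show ?thesis by (meson order.antisym order_refl)
qed

lemma quantale_SUP_imp:
  fixes f :: "'i \<Rightarrow> 'v::comm_quantale"
  shows "(SUP i\<in>I. f i) \<leadsto> z = (INF i\<in>I. f i \<leadsto> z)"
proof -
  have "w \<le> (SUP i\<in>I. f i) \<leadsto> z \<longleftrightarrow> w \<le> (INF i\<in>I. f i \<leadsto> z)" for w
    by (simp add: quantale_residuation[symmetric] le_INF_iff mult_Sup_distrib SUP_le_iff image_image)
  then show ?thesis by (meson order.antisym order_refl)
qed

lemma INF_Times:
  fixes f :: "'i \<times> 'j \<Rightarrow> 'v::complete_lattice"
  shows "(INF p\<in>I \<times> J. f p) = (INF i\<in>I. INF j\<in>J. f (i, j))"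
  by (rule order.antisym) (auto simp: le_INF_iff intro: INF_lower INF_lower2)

lemma vcat_refl: "vcategory X \<Longrightarrow> x \<in> obj X \<Longrightarrow> 1 \<le> hom X x x"
  by (simp add: vcategory_def)

lemma vcat_comp:
  "vcategory X \<Longrightarrow> x \<in> obj X \<Longrightarrow> y \<in> obj X \<Longrightarrow> z \<in> obj X \<Longrightarrow>
    hom X x y * hom X y z \<le> hom X x z"
  by (simp add: vcategory_def)

lemma vfunctor_obj: "vfunctor X Y f \<Longrightarrow> x \<in> obj X \<Longrightarrow> f x \<in> obj Y"
  by (auto simp: vfunctor_def)

lemma vfunctor_hom:
  "vfunctor X Y f \<Longrightarrow> x \<in> obj X \<Longrightarrow> y \<in> obj X \<Longrightarrow> hom X x y \<le> hom Y (f x) (f y)"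
  by (auto simp: vfunctor_def)

lemma hom_mono_left:
  assumes "vcategory X" "x \<in> obj X" "y \<in> obj X" "z \<in> obj X" "1 \<le> hom X x y"
  shows "hom X y z \<le> hom X x z"
proof -
  have "hom X y z = 1 * hom X y z" by simp
  also have "\<dots> \<le> hom X x y * hom X y z" using assms(5) by (intro quantale_mult_mono2) auto
  also have "\<dots> \<le> hom X x z" by (rule vcat_comp[OF assms(1-4)])
  finally show ?thesis .
qed

lemma vop_simps [simp]: "obj (vop X) = obj X" "hom (vop X) x y = hom X y x" "vop (vop X) = X"
  by (simp_all add: vop_def)

lemma vself_simps [simp]: "obj vself = UNIV" "hom vself = (\<leadsto>)"
  by (simp_all add: vself_def)

lemma vtensor_simps [simp]:
  "obj (X \<otimes>\<^sub>V Y) = obj X \<times> obj Y"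
  "hom (X \<otimes>\<^sub>V Y) (x, y) (x', y') = hom X x x' * hom Y y y'"
  by (simp_all add: vtensor_def)

lemma vcategory_vop: "vcategory X \<Longrightarrow> vcategory (vop X)"
  unfolding vcategory_def vop_simps by (metis mult.commute)

lemma vfunctor_vop_iff: "vfunctor (vop X) (vop Y) f \<longleftrightarrow> vfunctor X Y f"
  by (auto simp: vfunctor_def)

lemma hom_mono_right:
  assumes "vcategory X" "x \<in> obj X" "y \<in> obj X" "z \<in> obj X" "1 \<le> hom X y z"
  shows "hom X x y \<le> hom X x z"
  using hom_mono_left[OF vcategory_vop[OF assms(1)], of z y x] assms by simp

lemma viso_hom_left:
  assumes "vcategory X" "viso X x y" "x \<in> obj X" "y \<in> obj X" "z \<in> obj X"
  shows "hom X x z = hom X y z"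
  using assms by (intro order.antisym hom_mono_left) (auto simp: viso_def vle_def)

lemma viso_hom_right:
  assumes "vcategory X" "viso X x y" "x \<in> obj X" "y \<in> obj X" "z \<in> obj X"
  shows "hom X z x = hom X z y"
  using assms by (intro order.antisym hom_mono_right) (auto simp: viso_def vle_def)

lemma viso_sym: "viso X x y \<Longrightarrow> viso X y x"
  by (simp add: viso_def)

lemma viso_trans:
  assumes "vcategory X" "viso X x y" "viso X y z" "x \<in> obj X" "y \<in> obj X" "z \<in> obj X"
  shows "viso X x z"
  using assms hom_mono_right[of X x y z] hom_mono_right[of X z y x]
  by (auto simp: viso_def vle_def intro: order.trans)

lemma viso_if_hom_into_eq:
  assumes "vcategory X" "x \<in> obj X" "y \<in> obj X" "\<And>z. z \<in> obj X \<Longrightarrow> hom X z x = hom X z y"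
  shows "viso X x y"
  using assms vcat_refl[of X] by (auto simp: viso_def vle_def) metis

lemma hom_yoneda_out:
  assumes "vcategory X" "x \<in> obj X" "y \<in> obj X"
  shows "(INF z\<in>obj X. hom X y z \<leadsto> hom X x z) = hom X x y"
proof (rule order.antisym)
  have "(INF z\<in>obj X. hom X y z \<leadsto> hom X x z) \<le> hom X y y \<leadsto> hom X x y"
    using assms by (intro INF_lower) auto
  also have "\<dots> \<le> 1 \<leadsto> hom X x y" using assms vcat_refl by (intro quantale_imp_mono) auto
  finally show "(INF z\<in>obj X. hom X y z \<leadsto> hom X x z) \<le> hom X x y" by simp
  show "hom X x y \<le> (INF z\<in>obj X. hom X y z \<leadsto> hom X x z)"
    using assms vcat_comp[of X] by (auto simp: le_INF_iff quantale_residuation[symmetric])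
qed

lemma hom_yoneda_in:
  assumes "vcategory X" "x \<in> obj X" "y \<in> obj X"
  shows "(INF z\<in>obj X. hom X z x \<leadsto> hom X z y) = hom X x y"
  using hom_yoneda_out[OF vcategory_vop[OF assms(1)], of y x] assms by simp

lemma vfun_simps:
  "f \<in> obj (vfun X Y) \<longleftrightarrow> f \<in> extensional (obj X) \<and> vfunctor X Y f"
  "hom (vfun X Y) f g = (INF x\<in>obj X. hom Y (f x) (g x))"
  by (simp_all add: vfun_def)

lemma vfun_obj: "f \<in> obj (vfun X Y) \<Longrightarrow> x \<in> obj X \<Longrightarrow> f x \<in> obj Y"
  using vfunctor_obj[of X Y f x] by (simp add: vfun_simps)

lemma vfun_hom:
  "f \<in> obj (vfun X Y) \<Longrightarrow> x \<in> obj X \<Longrightarrow> y \<in> obj X \<Longrightarrow> hom X x y \<le> hom Y (f x) (f y)"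
  using vfunctor_hom[of X Y f x y] by (simp add: vfun_simps)

lemma vcategory_vfun:
  assumes "vcategory Y"
  shows "vcategory (vfun X Y)"
  unfolding vcategory_def
proof (intro conjI ballI)
  fix f assume "f \<in> obj (vfun X Y)"
  then show "1 \<le> hom (vfun X Y) f f"
    using vcat_refl[OF assms] vfun_obj by (fastforce simp: vfun_simps(2) le_INF_iff)
next
  fix f g h assume fgh: "f \<in> obj (vfun X Y)" "g \<in> obj (vfun X Y)" "h \<in> obj (vfun X Y)"
  show "hom (vfun X Y) f g * hom (vfun X Y) g h \<le> hom (vfun X Y) f h"
    unfolding vfun_simps(2) le_INF_iff
  proof
    fix x assume x: "x \<in> obj X"
    have "(INF x\<in>obj X. hom Y (f x) (g x)) * (INF x\<in>obj X. hom Y (g x) (h x))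
        \<le> hom Y (f x) (g x) * hom Y (g x) (h x)"
      using x by (intro quantale_mult_mono2 INF_lower)
    also have "\<dots> \<le> hom Y (f x) (h x)" using fgh x assms vfun_obj vcat_comp by metis
    finally show "(INF x\<in>obj X. hom Y (f x) (g x)) * (INF x\<in>obj X. hom Y (g x) (h x))
        \<le> hom Y (f x) (h x)" .
  qed
qed

lemma viso_vfun_if_pointwise:
  "(\<And>x. x \<in> obj X \<Longrightarrow> viso Y (f x) (g x)) \<Longrightarrow> viso (vfun X Y) f g"
  by (auto simp: viso_def vle_def vfun_simps(2) le_INF_iff)

section \<open>Equivalences\<close>

text \<open>An inverse can be chosen object by object, since full faithfulness makes any such choice
  functorial.\<close>

lemma vequivalent_iff_ff_eso:
  assumes C: "vcategory C" and D: "vcategory D"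
  shows "vequivalent C D \<longleftrightarrow>
    (\<exists>f. f \<in> obj C \<rightarrow> obj D \<and>
      (\<forall>x\<in>obj C. \<forall>y\<in>obj C. hom D (f x) (f y) = hom C x y) \<and>
      (\<forall>d\<in>obj D. \<exists>c\<in>obj C. viso D (f c) d))"
    (is "?l \<longleftrightarrow> ?r")
proof
  assume ?l
  then obtain f g where f: "vfunctor C D f" and g: "vfunctor D C g"
    and gf: "\<And>x. x \<in> obj C \<Longrightarrow> viso C (g (f x)) x"
    and fg: "\<And>y. y \<in> obj D \<Longrightarrow> viso D (f (g y)) y"
    unfolding vequivalent_def by blast
  have "hom D (f x) (f y) = hom C x y" if xy: "x \<in> obj C" "y \<in> obj C" for x y
  proof (rule order.antisym)
    have "hom D (f x) (f y) \<le> hom C (g (f x)) (g (f y))"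
      using f g xy vfunctor_hom vfunctor_obj by metis
    also have "\<dots> = hom C x (g (f y))"
      using viso_hom_left[OF C gf[OF xy(1)]] f g xy vfunctor_obj by metis
    also have "\<dots> = hom C x y"
      using viso_hom_right[OF C gf[OF xy(2)]] f g xy vfunctor_obj by metis
    finally show "hom D (f x) (f y) \<le> hom C x y" .
    show "hom C x y \<le> hom D (f x) (f y)" using f xy vfunctor_hom by metis
  qed
  moreover have "\<forall>d\<in>obj D. \<exists>c\<in>obj C. viso D (f c) d"
    using fg vfunctor_obj[OF g] by blast
  moreover have "f \<in> obj C \<rightarrow> obj D" using f by (simp add: vfunctor_def)
  ultimately show ?r by blast
next
  assume ?r
  then obtain f where f: "f \<in> obj C \<rightarrow> obj D"
    and ff: "\<And>x y. x \<in> obj C \<Longrightarrow> y \<in> obj C \<Longrightarrow> hom D (f x) (f y) = hom C x y"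
    and eso: "\<forall>d\<in>obj D. \<exists>c\<in>obj C. viso D (f c) d"
    by blast
  obtain g where g: "\<And>d. d \<in> obj D \<Longrightarrow> g d \<in> obj C \<and> viso D (f (g d)) d"
    using eso by metis
  have fg: "f (g d) \<in> obj D" if "d \<in> obj D" for d using f g that by blast
  have "hom D d e \<le> hom C (g d) (g e)" if de: "d \<in> obj D" "e \<in> obj D" for d e
  proof -
    have "hom D d e = hom D (f (g d)) e"
      using viso_hom_left[OF D, of "f (g d)" d e] g de fg by simp
    also have "\<dots> = hom D (f (g d)) (f (g e))"
      using viso_hom_right[OF D, of "f (g e)" e "f (g d)"] g de fg by simp
    also have "\<dots> = hom C (g d) (g e)" using ff g de by blast
    finally show ?thesis by simp
  qed
  then have "vfunctor D C g" using g by (auto simp: vfunctor_def)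
  moreover have "vfunctor C D f" using f ff by (auto simp: vfunctor_def)
  moreover have "viso C (g (f x)) x" if x: "x \<in> obj C" for x
  proof -
    have fx: "f x \<in> obj D" using f x by blast
    show ?thesis using g[OF fx] ff[of "g (f x)" x] ff[of x "g (f x)"] x
      by (simp add: viso_def vle_def)
  qed
  ultimately show ?l unfolding vequivalent_def using g by blast
qed

section \<open>Weighted limits and density\<close>

text \<open>The copresheaf generated by weights \<open>w j\<close> at the objects \<open>y j\<close> has as its infimum the
  weighted limit of the family, because by Yoneda the meet over \<open>y'\<close> of \<open>X(y j, y') \<leadsto> X(x, y')\<close>
  is \<open>X(x, y j)\<close>.\<close>

lemma INF_generated_copresheaf:
  fixes w :: "'j \<Rightarrow> 'v::comm_quantale"
  assumes X: "vcategory X" and y: "\<And>j. j \<in> J \<Longrightarrow> y j \<in> obj X" and x: "x \<in> obj X"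
  shows "(INF y'\<in>obj X. (SUP j\<in>J. hom X (y j) y' * w j) \<leadsto> hom X x y') =
    (INF j\<in>J. w j \<leadsto> hom X x (y j))"
proof -
  have "(INF y'\<in>obj X. (SUP j\<in>J. hom X (y j) y' * w j) \<leadsto> hom X x y') =
      (INF y'\<in>obj X. INF j\<in>J. w j \<leadsto> (hom X (y j) y' \<leadsto> hom X x y'))"
    by (simp add: quantale_SUP_imp mult.commute quantale_imp_mult[symmetric])
  also have "\<dots> = (INF j\<in>J. w j \<leadsto> (INF y'\<in>obj X. hom X (y j) y' \<leadsto> hom X x y'))"
    by (subst INF_commute) (simp add: quantale_imp_INF)
  also have "\<dots> = (INF j\<in>J. w j \<leadsto> hom X x (y j))"
    using hom_yoneda_out[OF X x] y by (intro INF_cong) auto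
  finally show ?thesis .
qed

lemma ex_weighted_limit:
  fixes w :: "'j \<Rightarrow> 'v::comm_quantale"
  assumes X: "vcategory X" "vcomplete X" and y: "\<And>j. j \<in> J \<Longrightarrow> y j \<in> obj X"
  shows "\<exists>i\<in>obj X. \<forall>x\<in>obj X. hom X x i = (INF j\<in>J. w j \<leadsto> hom X x (y j))"
proof -
  define \<nu> where "\<nu> = (\<lambda>y'\<in>obj X. SUP j\<in>J. hom X (y j) y' * w j)"
  have "hom X u v \<le> \<nu> u \<leadsto> \<nu> v" if uv: "u \<in> obj X" "v \<in> obj X" for u v
  proof -
    have "hom X u v * (hom X (y j) u * w j) \<le> \<nu> v" if j: "j \<in> J" for j
    proof -
      have "hom X u v * (hom X (y j) u * w j) = (hom X (y j) u * hom X u v) * w j"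
        by (simp add: mult.left_commute mult.commute)
      also have "\<dots> \<le> hom X (y j) v * w j"
        using vcat_comp[OF X(1)] uv y j by (intro quantale_mult_mono2) auto
      also have "\<dots> \<le> \<nu> v" using uv j unfolding \<nu>_def by (auto intro: SUP_upper)
      finally show ?thesis .
    qed
    then show ?thesis using uv
      by (simp add: quantale_residuation[symmetric] \<nu>_def mult_Sup_distrib SUP_le_iff image_image)
  qed
  then have "\<nu> \<in> copresheaves X"
    by (simp add: vfun_simps vfunctor_def \<nu>_def)
  then obtain i where "is_vinf X \<nu> i" using X unfolding vcomplete_def by blast
  then have "i \<in> obj X" "\<And>x. x \<in> obj X \<Longrightarrow> hom X x i = (INF j\<in>J. w j \<leadsto> hom X x (y j))"
    using INF_generated_copresheaf[OF X(1) y, where J = J and w = w]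
    by (auto simp: is_vinf_def \<nu>_def cong: INF_cong)
  then show ?thesis by blast
qed

text \<open>The supremum of \<open>\<mu>\<close> is the infimum of the copresheaf of its upper bounds.\<close>

lemma vcomplete_vop:
  assumes X: "vcategory X" "vcomplete X"
  shows "vcomplete (vop X)"
  unfolding vcomplete_def
proof
  fix \<mu> assume "\<mu> \<in> copresheaves (vop X)"
  define ub where "ub x = (INF y\<in>obj X. \<mu> y \<leadsto> hom X y x)" for x
  obtain i where i: "i \<in> obj X"
    and hi: "\<And>x. x \<in> obj X \<Longrightarrow> hom X x i = (INF y\<in>obj X. ub y \<leadsto> hom X x y)"
    using ex_weighted_limit[OF X, of "obj X" "\<lambda>y. y" ub] by auto
  have "hom X i x = ub x" if x: "x \<in> obj X" for x
  proof (rule order.antisym)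
    have "1 \<le> (INF y\<in>obj X. ub y \<leadsto> hom X i y)"
      using vcat_refl[OF X(1) i] hi[OF i] by simp
    also have "\<dots> \<le> ub x \<leadsto> hom X i x" using x by (rule INF_lower)
    finally show "ub x \<le> hom X i x" by (simp add: quantale_residuation[symmetric])
    show "hom X i x \<le> ub x"
      unfolding ub_def le_INF_iff
    proof
      fix y assume y: "y \<in> obj X"
      have "\<mu> y * ub z \<le> hom X y z" if "z \<in> obj X" for z
      proof -
        have "ub z \<le> \<mu> y \<leadsto> hom X y z" unfolding ub_def using y by (rule INF_lower)
        then show ?thesis by (simp add: quantale_residuation[symmetric] mult.commute)
      qed
      then have "\<mu> y \<le> hom X y i"
        using hi[OF y] by (simp add: le_INF_iff quantale_residuation[symmetric])
      then have "hom X i x * \<mu> y \<le> hom X y i * hom X i x"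
        by (subst mult.commute) (rule quantale_mult_mono2, auto)
      also have "\<dots> \<le> hom X y x" using vcat_comp[OF X(1)] x y i by blast
      finally show "hom X i x \<le> \<mu> y \<leadsto> hom X y x" by (simp add: quantale_residuation)
    qed
  qed
  then show "\<exists>i. is_vinf (vop X) \<mu> i"
    using i by (auto simp: is_vinf_def ub_def)
qed

lemma ex_weighted_colimit:
  fixes w :: "'j \<Rightarrow> 'v::comm_quantale"
  assumes X: "vcategory X" "vcomplete X" and y: "\<And>j. j \<in> J \<Longrightarrow> y j \<in> obj X"
  shows "\<exists>i\<in>obj X. \<forall>x\<in>obj X. hom X i x = (INF j\<in>J. w j \<leadsto> hom X (y j) x)"
  using ex_weighted_limit[OF vcategory_vop[OF X(1)] vcomplete_vop[OF X], of J y w] y by simp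

text \<open>The limit with constant weight \<open>1\<close> is a meet in the underlying preorder, and every meet is
  isomorphic to it; hence meets are automatically enriched.\<close>

lemma vmeet_hom:
  assumes X: "vcategory X" "vcomplete X" and S: "S \<subseteq> obj X"
  shows "vmeet X S \<in> obj X"
    and "x \<in> obj X \<Longrightarrow> hom X x (vmeet X S) = (INF s\<in>S. hom X x s)"
proof -
  obtain i where i: "i \<in> obj X"
    and hi: "\<And>x. x \<in> obj X \<Longrightarrow> hom X x i = (INF s\<in>S. hom X x s)"
    using ex_weighted_limit[OF X, of S "\<lambda>s. s" "\<lambda>_. 1"] S by auto
  have le_i: "vle X u i \<longleftrightarrow> (\<forall>s\<in>S. vle X u s)" if "u \<in> obj X" for u
    using hi[OF that] by (simp add: vle_def le_INF_iff)
  have "vle X i i" using vcat_refl[OF X(1) i] by (simp add: vle_def)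
  then have "is_meet X S i"
    using i le_i by (auto simp: is_meet_def)
  then have m: "is_meet X S (vmeet X S)" unfolding vmeet_def by (rule someI)
  then show mo: "vmeet X S \<in> obj X" by (simp add: is_meet_def)
  have "viso X (vmeet X S) i"
    using m le_i i \<open>vle X i i\<close> mo by (auto simp: is_meet_def viso_def)
  then show "x \<in> obj X \<Longrightarrow> hom X x (vmeet X S) = (INF s\<in>S. hom X x s)"
    using viso_hom_right[OF X(1) _ mo i] hi by simp
qed

lemma vjoin_eq_vmeet_vop: "vjoin X S = vmeet (vop X) S"
  by (simp add: vjoin_def vmeet_def is_join_def is_meet_def vle_def)

lemma vjoin_hom:
  assumes X: "vcategory X" "vcomplete X" and S: "S \<subseteq> obj X"
  shows "vjoin X S \<in> obj X"
    and "x \<in> obj X \<Longrightarrow> hom X (vjoin X S) x = (INF s\<in>S. hom X s x)"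
  using vmeet_hom[OF vcategory_vop[OF X(1)] vcomplete_vop[OF X], of S] S
  by (simp_all add: vjoin_eq_vmeet_vop)

text \<open>If some weight \<open>\<nu>\<close> exhibits \<open>y\<close> as a limit of values of \<open>f\<close>, then \<open>\<nu> x \<le> hom Y y (f x)\<close>, and
  replacing \<open>\<nu>\<close> by this largest possible weight does not change the limit.  So codensity can be
  tested with the canonical weights.\<close>

lemma vcodense_iff_canonical:
  assumes Y: "vcategory Y"
  shows "vcodense X Y f \<longleftrightarrow> vfunctor X Y f \<and>
    (\<forall>y\<in>obj Y. \<forall>z\<in>obj Y.
      hom Y z y = (INF x\<in>obj X. hom Y y (f x) \<leadsto> hom Y z (f x)))"
proof (cases "vfunctor X Y f")
  case f: True
  have fo: "f x \<in> obj Y" if "x \<in> obj X" for x using f that by (rule vfunctor_obj)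
  have inf_iff: "is_vinf Y (\<lambda>y'\<in>obj Y. SUP x\<in>obj X. hom Y (f x) y' * \<nu> x) y \<longleftrightarrow>
      (\<forall>z\<in>obj Y. hom Y z y = (INF x\<in>obj X. \<nu> x \<leadsto> hom Y z (f x)))"
    if "y \<in> obj Y" for \<nu> y
    using that INF_generated_copresheaf[OF Y fo, where J = "obj X" and w = \<nu>]
    by (simp add: is_vinf_def cong: INF_cong)
  have "(\<exists>\<nu>\<in>copresheaves X. \<forall>z\<in>obj Y. hom Y z y = (INF x\<in>obj X. \<nu> x \<leadsto> hom Y z (f x))) \<longleftrightarrow>
      (\<forall>z\<in>obj Y. hom Y z y = (INF x\<in>obj X. hom Y y (f x) \<leadsto> hom Y z (f x)))"
    (is "?some \<longleftrightarrow> ?canonical") if y: "y \<in> obj Y" for y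
  proof
    assume ?some
    then obtain \<nu> where \<nu>: "\<And>z. z \<in> obj Y \<Longrightarrow> hom Y z y = (INF x\<in>obj X. \<nu> x \<leadsto> hom Y z (f x))"
      by blast
    have le: "\<nu> x \<le> hom Y y (f x)" if "x \<in> obj X" for x
      using \<nu>[OF y] vcat_refl[OF Y y] that
      by (simp add: le_INF_iff quantale_residuation[symmetric])
    show ?canonical
    proof (intro ballI order.antisym)
      fix z assume z: "z \<in> obj Y"
      show "hom Y z y \<le> (INF x\<in>obj X. hom Y y (f x) \<leadsto> hom Y z (f x))"
        using vcat_comp[OF Y z y fo] by (simp add: le_INF_iff quantale_residuation[symmetric])
      show "(INF x\<in>obj X. hom Y y (f x) \<leadsto> hom Y z (f x)) \<le> hom Y z y"
        unfolding \<nu>[OF z] by (intro INF_superset_mono quantale_imp_mono le) auto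
    qed
  next
    assume c: ?canonical
    have "hom X u v \<le> hom Y y (f u) \<leadsto> hom Y y (f v)" if uv: "u \<in> obj X" "v \<in> obj X" for u v
    proof -
      have "hom X u v * hom Y y (f u) \<le> hom Y y (f u) * hom Y (f u) (f v)"
        by (subst mult.commute) (use vfunctor_hom[OF f] uv in \<open>auto intro: quantale_mult_mono\<close>)
      also have "\<dots> \<le> hom Y y (f v)" using vcat_comp[OF Y] y fo uv by blast
      finally show ?thesis by (simp add: quantale_residuation)
    qed
    then have "(\<lambda>x\<in>obj X. hom Y y (f x)) \<in> copresheaves X"
      by (simp add: vfun_simps vfunctor_def)
    then show ?some
      using c by (intro bexI[of _ "\<lambda>x\<in>obj X. hom Y y (f x)"]) (auto cong: INF_cong)
  qed
  then show ?thesis using f inf_iff by (simp add: vcodense_def)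
qed (simp add: vcodense_def)

lemma vdense_iff_vcodense_vop: "vdense X Y f \<longleftrightarrow> vcodense (vop X) (vop Y) f"
  by (simp add: vdense_def vcodense_def vfunctor_vop_iff is_vsup_def is_vinf_def)

lemma vdense_iff_canonical:
  assumes Y: "vcategory Y"
  shows "vdense X Y f \<longleftrightarrow> vfunctor X Y f \<and>
    (\<forall>y\<in>obj Y. \<forall>z\<in>obj Y.
      hom Y y z = (INF x\<in>obj X. hom Y (f x) y \<leadsto> hom Y (f x) z))"
  using vcodense_iff_canonical[OF vcategory_vop[OF Y], of "vop X" f]
  by (simp add: vdense_iff_vcodense_vop vfunctor_vop_iff)

section \<open>The adjunction between the two functor categories\<close>

locale isbell_adjunction =
  fixes X :: "('x, 'v::comm_quantale) vcat"
    and Y :: "('y, 'v) vcat"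
    and Z :: "('z, 'v) vcat"
    and A :: "('a, 'v) vcat"
    and B :: "('b, 'v) vcat"
    and t :: "'x \<times> 'y \<Rightarrow> 'z"
    and l :: "'z \<times> 'y \<Rightarrow> 'x"
    and r :: "'x \<times> 'z \<Rightarrow> 'y"
    and \<psi> :: "'a \<times> 'b \<Rightarrow> 'y"
  assumes X: "vcategory X" "vcomplete X"
    and Z: "vcategory Z" "vcomplete Z"
    and adj: "two_var_adjunction X Y Z t l r"
    and A: "vcategory A" and B: "vcategory B"
    and \<psi>: "vfunctor (vop A \<otimes>\<^sub>V B) Y \<psi>"
begin

abbreviation "P \<equiv> vfun (vop B) X"
abbreviation "Q \<equiv> vfun (vop A) Z"
abbreviation "up \<equiv> psi_upper t Z A B \<psi>"
abbreviation "lo \<equiv> psi_lower l X A B \<psi>"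
abbreviation "K\<psi> \<equiv> K t l X Z A B \<psi>"

lemma t_obj: "x \<in> obj X \<Longrightarrow> y \<in> obj Y \<Longrightarrow> t (x, y) \<in> obj Z"
  and l_obj: "z \<in> obj Z \<Longrightarrow> y \<in> obj Y \<Longrightarrow> l (z, y) \<in> obj X"
  using adj by (auto simp: two_var_adjunction_def vfunctor_def)

lemma \<psi>_obj: "a \<in> obj A \<Longrightarrow> b \<in> obj B \<Longrightarrow> \<psi> (a, b) \<in> obj Y"
  using \<psi> by (auto simp: vfunctor_def)

lemma hom_t: "x \<in> obj X \<Longrightarrow> y \<in> obj Y \<Longrightarrow> z \<in> obj Z \<Longrightarrow> hom Z (t (x, y)) z = hom X x (l (z, y))"
  and hom_r: "x \<in> obj X \<Longrightarrow> y \<in> obj Y \<Longrightarrow> z \<in> obj Z \<Longrightarrow> hom Y y (r (x, z)) = hom X x (l (z, y))"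
  using adj by (auto simp: two_var_adjunction_def)

lemma \<psi>_hom:
  assumes "a \<in> obj A" "a' \<in> obj A" "b \<in> obj B" "b' \<in> obj B"
  shows "hom A a' a * hom B b b' \<le> hom Y (\<psi> (a, b)) (\<psi> (a', b'))"
  using vfunctor_hom[OF \<psi>, of "(a, b)" "(a', b')"] assms by simp

lemma \<psi>_hom_left:
  assumes "a \<in> obj A" "a' \<in> obj A" "b \<in> obj B"
  shows "hom A a' a \<le> hom Y (\<psi> (a, b)) (\<psi> (a', b))"
proof -
  have "hom A a' a * 1 \<le> hom A a' a * hom B b b"
    using vcat_refl[OF B assms(3)] by (rule quantale_mult_mono)
  then show ?thesis using \<psi>_hom[of a a' b b] assms by simp
qed

lemma \<psi>_hom_right:
  assumes "a \<in> obj A" "b \<in> obj B" "b' \<in> obj B"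
  shows "hom B b b' \<le> hom Y (\<psi> (a, b)) (\<psi> (a, b'))"
proof -
  have "hom B b b' * 1 \<le> hom B b b' * hom A a a"
    using vcat_refl[OF A assms(1)] by (rule quantale_mult_mono)
  then show ?thesis using \<psi>_hom[of a a b b'] assms by (simp add: mult.commute)
qed

lemma l_hom_right:
  assumes z: "z \<in> obj Z" and y: "y \<in> obj Y" "y' \<in> obj Y"
  shows "hom Y y y' \<le> hom X (l (z, y')) (l (z, y))"
proof -
  have "vfunctor (Z \<otimes>\<^sub>V vop Y) X l" using adj by (simp add: two_var_adjunction_def)
  then have "hom Z z z * hom Y y y' \<le> hom X (l (z, y')) (l (z, y))"
    using vfunctor_hom[of "Z \<otimes>\<^sub>V vop Y" X l "(z, y')" "(z, y)"] z y by simp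
  moreover have "hom Y y y' * 1 \<le> hom Y y y' * hom Z z z"
    using vcat_refl[OF Z(1) z] by (rule quantale_mult_mono)
  ultimately show ?thesis by (simp add: mult.commute)
qed

lemma t_hom_right:
  assumes x: "x \<in> obj X" and y: "y \<in> obj Y" "y' \<in> obj Y"
  shows "hom Y y y' \<le> hom Z (t (x, y)) (t (x, y'))"
proof -
  have "vfunctor (X \<otimes>\<^sub>V Y) Z t" using adj by (simp add: two_var_adjunction_def)
  then have "hom X x x * hom Y y y' \<le> hom Z (t (x, y)) (t (x, y'))"
    using vfunctor_hom[of "X \<otimes>\<^sub>V Y" Z t "(x, y)" "(x, y')"] x y by simp
  moreover have "hom Y y y' * 1 \<le> hom Y y y' * hom X x x"
    using vcat_refl[OF X(1) x] by (rule quantale_mult_mono)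
  ultimately show ?thesis by (simp add: mult.commute)
qed

lemma P_obj: "\<nu> \<in> obj P \<Longrightarrow> b \<in> obj B \<Longrightarrow> \<nu> b \<in> obj X"
  and Q_obj: "\<mu> \<in> obj Q \<Longrightarrow> a \<in> obj A \<Longrightarrow> \<mu> a \<in> obj Z"
  using vfun_obj by fastforce+

lemma P_hom: "\<nu> \<in> obj P \<Longrightarrow> b \<in> obj B \<Longrightarrow> b' \<in> obj B \<Longrightarrow> hom B b b' \<le> hom X (\<nu> b') (\<nu> b)"
  and Q_hom: "\<mu> \<in> obj Q \<Longrightarrow> a \<in> obj A \<Longrightarrow> a' \<in> obj A \<Longrightarrow> hom A a a' \<le> hom Z (\<mu> a') (\<mu> a)"
  using vfun_hom[of \<nu> "vop B" X b' b] vfun_hom[of \<mu> "vop A" Z a' a] by simp_all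

lemmas P = vcategory_vfun[OF X(1), of "vop B"]
lemmas Q = vcategory_vfun[OF Z(1), of "vop A"]

lemma hom_P: "hom P \<nu> \<nu>' = (INF b\<in>obj B. hom X (\<nu> b) (\<nu>' b))"
  and hom_Q: "hom Q \<mu> \<mu>' = (INF a\<in>obj A. hom Z (\<mu> a) (\<mu>' a))"
  by (simp_all add: vfun_simps)

lemma up_hom:
  assumes \<nu>: "\<nu> \<in> obj P" and a: "a \<in> obj A"
  shows "up \<nu> a \<in> obj Z"
    and "z \<in> obj Z \<Longrightarrow> hom Z (up \<nu> a) z = (INF b\<in>obj B. hom Z (t (\<nu> b, \<psi> (a, b))) z)"
proof -
  have S: "(\<lambda>b. t (\<nu> b, \<psi> (a, b))) ` obj B \<subseteq> obj Z"
    using P_obj[OF \<nu>] t_obj \<psi>_obj[OF a] by blast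
  show "up \<nu> a \<in> obj Z"
    using a vjoin_hom(1)[OF Z S] by (simp add: psi_upper_def)
  show "z \<in> obj Z \<Longrightarrow> hom Z (up \<nu> a) z = (INF b\<in>obj B. hom Z (t (\<nu> b, \<psi> (a, b))) z)"
    using a vjoin_hom(2)[OF Z S] by (simp add: psi_upper_def image_image)
qed

lemma lo_hom:
  assumes \<mu>: "\<mu> \<in> obj Q" and b: "b \<in> obj B"
  shows "lo \<mu> b \<in> obj X"
    and "x \<in> obj X \<Longrightarrow> hom X x (lo \<mu> b) = (INF a\<in>obj A. hom X x (l (\<mu> a, \<psi> (a, b))))"
proof -
  have S: "(\<lambda>a. l (\<mu> a, \<psi> (a, b))) ` obj A \<subseteq> obj X"
    using Q_obj[OF \<mu>] l_obj \<psi>_obj[OF _ b] by blast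
  show "lo \<mu> b \<in> obj X"
    using b vmeet_hom(1)[OF X S] by (simp add: psi_lower_def)
  show "x \<in> obj X \<Longrightarrow> hom X x (lo \<mu> b) = (INF a\<in>obj A. hom X x (l (\<mu> a, \<psi> (a, b))))"
    using b vmeet_hom(2)[OF X S] by (simp add: psi_lower_def image_image)
qed

lemma lo_in_Q_P:
  assumes \<mu>: "\<mu> \<in> obj Q"
  shows "lo \<mu> \<in> obj P"
proof -
  have "hom B b' b \<le> hom X (lo \<mu> b) (lo \<mu> b')" if b: "b \<in> obj B" "b' \<in> obj B" for b b'
    unfolding lo_hom(2)[OF \<mu> b(2) lo_hom(1)[OF \<mu> b(1)]] le_INF_iff
  proof
    fix a assume a: "a \<in> obj A"
    note o = lo_hom(1)[OF \<mu> b(1)] l_obj[OF Q_obj[OF \<mu> a] \<psi>_obj[OF a b(1)]]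
      l_obj[OF Q_obj[OF \<mu> a] \<psi>_obj[OF a b(2)]]
    have "1 \<le> hom X (lo \<mu> b) (l (\<mu> a, \<psi> (a, b)))"
      using vcat_refl[OF X(1) o(1)] lo_hom(2)[OF \<mu> b(1) o(1)] a by (simp add: le_INF_iff)
    then have "hom X (l (\<mu> a, \<psi> (a, b))) (l (\<mu> a, \<psi> (a, b')))
        \<le> hom X (lo \<mu> b) (l (\<mu> a, \<psi> (a, b')))"
      using hom_mono_left[OF X(1)] o by blast
    moreover have "hom B b' b \<le> hom X (l (\<mu> a, \<psi> (a, b))) (l (\<mu> a, \<psi> (a, b')))"
      using \<psi>_hom_right[OF a b(2,1)] l_hom_right[OF Q_obj[OF \<mu> a] \<psi>_obj[OF a b(2)] \<psi>_obj[OF a b(1)]]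
      by (rule order.trans)
    ultimately show "hom B b' b \<le> hom X (lo \<mu> b) (l (\<mu> a, \<psi> (a, b')))" by (rule order.trans[rotated])
  qed
  then show ?thesis
    using lo_hom(1)[OF \<mu>] by (auto simp: vfun_simps vfunctor_def psi_lower_def)
qed

lemma up_in_P_Q:
  assumes \<nu>: "\<nu> \<in> obj P"
  shows "up \<nu> \<in> obj Q"
proof -
  have "hom A a' a \<le> hom Z (up \<nu> a) (up \<nu> a')" if a: "a \<in> obj A" "a' \<in> obj A" for a a'
    unfolding up_hom(2)[OF \<nu> a(1) up_hom(1)[OF \<nu> a(2)]] le_INF_iff
  proof
    fix b assume b: "b \<in> obj B"
    note o = up_hom(1)[OF \<nu> a(2)] t_obj[OF P_obj[OF \<nu> b] \<psi>_obj[OF a(1) b]]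
      t_obj[OF P_obj[OF \<nu> b] \<psi>_obj[OF a(2) b]]
    have "1 \<le> hom Z (t (\<nu> b, \<psi> (a', b))) (up \<nu> a')"
      using vcat_refl[OF Z(1) o(1)] up_hom(2)[OF \<nu> a(2) o(1)] b by (simp add: le_INF_iff)
    then have "hom Z (t (\<nu> b, \<psi> (a, b))) (t (\<nu> b, \<psi> (a', b)))
        \<le> hom Z (t (\<nu> b, \<psi> (a, b))) (up \<nu> a')"
      using hom_mono_right[OF Z(1)] o by blast
    moreover have "hom A a' a \<le> hom Z (t (\<nu> b, \<psi> (a, b))) (t (\<nu> b, \<psi> (a', b)))"
      using \<psi>_hom_left[OF a b] t_hom_right[OF P_obj[OF \<nu> b] \<psi>_obj[OF a(1) b] \<psi>_obj[OF a(2) b]]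
      by (rule order.trans)
    ultimately show "hom A a' a \<le> hom Z (t (\<nu> b, \<psi> (a, b))) (up \<nu> a')" by (rule order.trans[rotated])
  qed
  then show ?thesis
    using up_hom(1)[OF \<nu>] by (auto simp: vfun_simps vfunctor_def psi_upper_def)
qed

lemma up_lo_adjoint:
  assumes \<nu>: "\<nu> \<in> obj P" and \<mu>: "\<mu> \<in> obj Q"
  shows "hom Q (up \<nu>) \<mu> = hom P \<nu> (lo \<mu>)"
proof -
  have "hom Q (up \<nu>) \<mu> = (INF a\<in>obj A. INF b\<in>obj B. hom X (\<nu> b) (l (\<mu> a, \<psi> (a, b))))"
    unfolding hom_Q
    by (intro INF_cong refl) (simp add: up_hom[OF \<nu>] Q_obj[OF \<mu>] P_obj[OF \<nu>] hom_t \<psi>_obj cong: INF_cong)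
  also have "\<dots> = (INF b\<in>obj B. INF a\<in>obj A. hom X (\<nu> b) (l (\<mu> a, \<psi> (a, b))))"
    by (rule INF_commute)
  also have "\<dots> = hom P \<nu> (lo \<mu>)"
    unfolding hom_P by (intro INF_cong refl) (simp add: lo_hom[OF \<mu>] P_obj[OF \<nu>])
  finally show ?thesis .
qed

lemma up_mono:
  assumes \<nu>: "\<nu> \<in> obj P" "\<nu>' \<in> obj P"
  shows "hom P \<nu> \<nu>' \<le> hom Q (up \<nu>) (up \<nu>')"
proof -
  note u = up_in_P_Q[OF \<nu>(2)]
  have "1 \<le> hom P \<nu>' (lo (up \<nu>'))"
    using vcat_refl[OF Q u] up_lo_adjoint[OF \<nu>(2) u] by simp
  then have "hom P \<nu> \<nu>' \<le> hom P \<nu> (lo (up \<nu>'))"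
    using hom_mono_right[OF P] \<nu> lo_in_Q_P[OF u] by blast
  then show ?thesis using up_lo_adjoint[OF \<nu>(1) u] by simp
qed

lemma lo_mono:
  assumes \<mu>: "\<mu> \<in> obj Q" "\<mu>' \<in> obj Q"
  shows "hom Q \<mu> \<mu>' \<le> hom P (lo \<mu>) (lo \<mu>')"
proof -
  note u = lo_in_Q_P[OF \<mu>(1)]
  have "1 \<le> hom Q (up (lo \<mu>)) \<mu>"
    using vcat_refl[OF P u] up_lo_adjoint[OF u \<mu>(1)] by simp
  then have "hom Q \<mu> \<mu>' \<le> hom Q (up (lo \<mu>)) \<mu>'"
    using hom_mono_left[OF Q] \<mu> up_in_P_Q[OF u] by blast
  then show ?thesis using up_lo_adjoint[OF u \<mu>(2)] by simp
qed

lemma unit: "\<nu> \<in> obj P \<Longrightarrow> 1 \<le> hom P \<nu> (lo (up \<nu>))"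
  using vcat_refl[OF Q up_in_P_Q] up_lo_adjoint up_in_P_Q by metis

lemma counit: "\<mu> \<in> obj Q \<Longrightarrow> 1 \<le> hom Q (up (lo \<mu>)) \<mu>"
  using vcat_refl[OF P lo_in_Q_P] up_lo_adjoint lo_in_Q_P by metis

lemma K_simps:
  "\<nu> \<in> obj K\<psi> \<longleftrightarrow> \<nu> \<in> obj P \<and> viso P (lo (up \<nu>)) \<nu>"
  "hom K\<psi> = hom P"
  by (simp_all add: K_def)

lemma viso_K: "viso K\<psi> = viso P"
  by (intro ext) (simp add: viso_def vle_def K_simps)

lemma vcategory_K: "vcategory K\<psi>"
  using P by (auto simp: vcategory_def K_simps)

lemma K_iff: "\<nu> \<in> obj K\<psi> \<longleftrightarrow> \<nu> \<in> obj P \<and> 1 \<le> hom P (lo (up \<nu>)) \<nu>"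
  using unit by (auto simp: K_simps viso_def vle_def)

text \<open>The triangle identity: \<open>lo\<close> of the counit inverts the unit at \<open>lo \<mu>\<close>.\<close>

lemma lo_in_K:
  assumes \<mu>: "\<mu> \<in> obj Q"
  shows "lo \<mu> \<in> obj K\<psi>"
  using counit[OF \<mu>] lo_mono[OF up_in_P_Q[OF lo_in_Q_P[OF \<mu>]] \<mu>] lo_in_Q_P[OF \<mu>]
  by (auto simp: K_iff intro: order.trans)

text \<open>One inequality is precomposition with the unit; the other applies the monotone \<open>lo \<circ> up\<close> and
  then uses that \<open>\<nu>\<close> is fixed.\<close>

lemma K_reflection:
  assumes \<kappa>: "\<kappa> \<in> obj P" and \<nu>: "\<nu> \<in> obj K\<psi>"
  shows "hom P (lo (up \<kappa>)) \<nu> = hom P \<kappa> \<nu>"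
proof (rule order.antisym)
  have \<nu>P: "\<nu> \<in> obj P" and i: "viso P (lo (up \<nu>)) \<nu>" using \<nu> by (auto simp: K_simps)
  note c = lo_in_Q_P[OF up_in_P_Q]
  show "hom P (lo (up \<kappa>)) \<nu> \<le> hom P \<kappa> \<nu>"
    using hom_mono_left[OF P \<kappa> c[OF \<kappa>] \<nu>P unit[OF \<kappa>]] .
  have "hom P \<kappa> \<nu> \<le> hom P (lo (up \<kappa>)) (lo (up \<nu>))"
    using up_mono[OF \<kappa> \<nu>P] lo_mono[OF up_in_P_Q[OF \<kappa>] up_in_P_Q[OF \<nu>P]] by (rule order.trans)
  also have "\<dots> = hom P (lo (up \<kappa>)) \<nu>"
    using viso_hom_right[OF P i c[OF \<nu>P] \<nu>P c[OF \<kappa>]] .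
  finally show "hom P \<kappa> \<nu> \<le> hom P (lo (up \<kappa>)) \<nu>" .
qed

text \<open>So \<open>up\<close> is fully faithful on fixed points, which transports codensity questions to \<open>Q\<close>.\<close>

lemma hom_P_eq_hom_Q:
  assumes "\<nu> \<in> obj P" "\<nu>' \<in> obj K\<psi>"
  shows "hom P \<nu> \<nu>' = hom Q (up \<nu>) (up \<nu>')"
proof -
  have \<nu>'P: "\<nu>' \<in> obj P" and i: "viso P (lo (up \<nu>')) \<nu>'" using assms by (auto simp: K_simps)
  show ?thesis
    using viso_hom_right[OF P i lo_in_Q_P[OF up_in_P_Q[OF \<nu>'P]] \<nu>'P assms(1)]
      up_lo_adjoint[OF assms(1) up_in_P_Q[OF \<nu>'P]] by simp
qed

section \<open>Free and cofree functors\<close>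

text \<open>The functor freely generated by \<open>x\<close> at \<open>b\<close> is \<open>b' \<mapsto> B(b', b) \<cdot> x\<close>, where \<open>v \<cdot> x\<close> is the tensor,
  that is, the colimit of \<open>x\<close> weighted by \<open>v\<close>.  Its universal property is then Yoneda in \<open>B\<close>.\<close>

lemma ex_free_functor:
  assumes b: "b \<in> obj B" and x: "x \<in> obj X"
  shows "\<exists>\<kappa>\<in>obj P. \<forall>\<nu>\<in>obj P. hom P \<kappa> \<nu> = hom X x (\<nu> b)"
proof -
  have "\<exists>i. i \<in> obj X \<and> (\<forall>u\<in>obj X. hom X i u = hom B b' b \<leadsto> hom X x u)" for b'
    using ex_weighted_colimit[OF X, of "{()}" "\<lambda>_. x" "\<lambda>_. hom B b' b"] x by auto
  then obtain T where T: "\<And>b'. T b' \<in> obj X"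
    and hT: "\<And>b' u. u \<in> obj X \<Longrightarrow> hom X (T b') u = hom B b' b \<leadsto> hom X x u"
    by metis
  have unitT: "hom B b' b \<le> hom X x (T b')" for b'
    using vcat_refl[OF X(1) T, of b'] hT[OF T, of b' b'] by (simp add: quantale_residuation[symmetric])
  have "hom B b2 b1 \<le> hom X (T b1) (T b2)" if bs: "b1 \<in> obj B" "b2 \<in> obj B" for b1 b2
    using order.trans[OF vcat_comp[OF B bs(2,1) b] unitT]
    by (simp add: hT[OF T] quantale_residuation[symmetric])
  then have "restrict T (obj B) \<in> obj P"
    using T by (auto simp: vfun_simps vfunctor_def)
  moreover have "hom P (restrict T (obj B)) \<nu> = hom X x (\<nu> b)" if \<nu>: "\<nu> \<in> obj P" for \<nu>
  proof -
    have "hom P (restrict T (obj B)) \<nu> = (INF b'\<in>obj B. hom B b' b \<leadsto> hom X x (\<nu> b'))"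
      unfolding hom_P using hT P_obj[OF \<nu>] by (intro INF_cong) auto
    also have "\<dots> = hom X x (\<nu> b)"
    proof (rule order.antisym)
      have "(INF b'\<in>obj B. hom B b' b \<leadsto> hom X x (\<nu> b')) \<le> hom B b b \<leadsto> hom X x (\<nu> b)"
        using b by (intro INF_lower)
      also have "\<dots> \<le> 1 \<leadsto> hom X x (\<nu> b)" using vcat_refl[OF B b] by (intro quantale_imp_mono) auto
      finally show "(INF b'\<in>obj B. hom B b' b \<leadsto> hom X x (\<nu> b')) \<le> hom X x (\<nu> b)" by simp
      show "hom X x (\<nu> b) \<le> (INF b'\<in>obj B. hom B b' b \<leadsto> hom X x (\<nu> b'))"
        unfolding le_INF_iff quantale_residuation[symmetric]
      proof
        fix b' assume b': "b' \<in> obj B"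
        have "hom X x (\<nu> b) * hom B b' b \<le> hom X x (\<nu> b) * hom X (\<nu> b) (\<nu> b')"
          using P_hom[OF \<nu> b' b] by (rule quantale_mult_mono)
        also have "\<dots> \<le> hom X x (\<nu> b')" using vcat_comp[OF X(1)] x P_obj[OF \<nu>] b b' by blast
        finally show "hom X x (\<nu> b) * hom B b' b \<le> hom X x (\<nu> b')" .
      qed
    qed
    finally show ?thesis .
  qed
  ultimately show ?thesis by blast
qed

end

text \<open>Exchanging \<open>X\<close> with \<open>Z\<^sup>o\<^sup>p\<close> and \<open>A\<close> with \<open>B\<^sup>o\<^sup>p\<close> is a symmetry of the situation,
  under which tensors become cotensors.\<close>

lemma isbell_adjunction_dual:
  assumes "isbell_adjunction X Y Z A B t l r \<psi>"
  shows "isbell_adjunction (vop Z) Y (vop X) (vop B) (vop A) l t (\<lambda>(z, x). r (x, z)) (\<lambda>(b, a). \<psi> (a, b))"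
proof -
  interpret isbell_adjunction X Y Z A B t l r \<psi> by fact
  show ?thesis
    by unfold_locales
      (use X Z adj A B \<psi> in \<open>auto simp: vcategory_vop vcomplete_vop two_var_adjunction_def
        vfunctor_def mult.commute\<close>)
qed

context isbell_adjunction
begin

lemma ex_cofree_functor:
  assumes a: "a \<in> obj A" and z: "z \<in> obj Z"
  shows "\<exists>\<kappa>\<in>obj Q. \<forall>\<mu>\<in>obj Q. hom Q \<mu> \<kappa> = hom Z (\<mu> a) z"
proof -
  interpret dual: isbell_adjunction "vop Z" Y "vop X" "vop B" "vop A" l t
      "\<lambda>(z, x). r (x, z)" "\<lambda>(b, a). \<psi> (a, b)"
    by (rule isbell_adjunction_dual) unfold_locales
  have "obj dual.P = obj Q" "\<And>f g. hom dual.P f g = hom Q g f"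
    using vfunctor_vop_iff[of "vop A" Z] by (auto simp: vfun_def)
  then show ?thesis using dual.ex_free_functor[of a z] a z by simp
qed

section \<open>Recovering the bifunctors from an equivalence\<close>

text \<open>\<open>F\<close> is the composite of \<open>C \<simeq> K\<psi>\<close> with the inclusion into \<open>P\<close>.\<close>

context
  fixes C :: "('c, 'v) vcat" and F :: "'c \<Rightarrow> 'b \<Rightarrow> 'x"
  assumes C: "vcategory C"
    and F_K: "\<And>c. c \<in> obj C \<Longrightarrow> F c \<in> obj K\<psi>"
    and F_ff: "\<And>c d. c \<in> obj C \<Longrightarrow> d \<in> obj C \<Longrightarrow> hom P (F c) (F d) = hom C c d"
    and F_eso: "\<And>\<nu>. \<nu> \<in> obj K\<psi> \<Longrightarrow> \<exists>c\<in>obj C. viso P (F c) \<nu>"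
begin

lemma F_P: "c \<in> obj C \<Longrightarrow> F c \<in> obj P"
  using F_K K_simps by blast

text \<open>Limits are computed pointwise in \<open>P\<close>.  The limit \<open>L\<close> of fixed points \<open>F c\<close> is again fixed: by
  reflection \<open>L\<close> and its closure \<open>lo (up L)\<close> have the same homs into every \<open>F c\<close>, hence into \<open>L\<close>, and
  so the identity of \<open>L\<close> yields \<open>lo (up L) \<le> L\<close>.\<close>

lemma vcomplete_if_ff_eso: "vcomplete C"
  unfolding vcomplete_def
proof
  fix w assume "w \<in> copresheaves C"
  have "\<exists>i. i \<in> obj X \<and> (\<forall>x\<in>obj X. hom X x i = (INF c\<in>obj C. w c \<leadsto> hom X x (F c b)))"
    if "b \<in> obj B" for b
    using ex_weighted_limit[OF X, of "obj C" "\<lambda>c. F c b" w] P_obj[OF F_P] that by auto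
  then obtain L where L: "\<And>b. b \<in> obj B \<Longrightarrow> L b \<in> obj X"
    and hL: "\<And>b x. b \<in> obj B \<Longrightarrow> x \<in> obj X \<Longrightarrow>
      hom X x (L b) = (INF c\<in>obj C. w c \<leadsto> hom X x (F c b))"
    by metis
  have "hom B b' b \<le> hom X (L b) (L b')" if b: "b \<in> obj B" "b' \<in> obj B" for b b'
    unfolding hL[OF b(2) L[OF b(1)]] le_INF_iff quantale_residuation[symmetric]
  proof
    fix c assume c: "c \<in> obj C"
    have "w c \<le> hom X (L b) (F c b)"
      using vcat_refl[OF X(1) L[OF b(1)]] hL[OF b(1) L[OF b(1)]] c
      by (simp add: le_INF_iff quantale_residuation[symmetric])
    moreover have "hom B b' b \<le> hom X (F c b) (F c b')" using P_hom[OF F_P[OF c]] b by blast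
    ultimately have "w c * hom B b' b \<le> hom X (L b) (F c b) * hom X (F c b) (F c b')"
      by (rule quantale_mult_mono2)
    also have "\<dots> \<le> hom X (L b) (F c b')"
      using vcat_comp[OF X(1)] L b P_obj[OF F_P[OF c]] by blast
    finally show "hom B b' b * w c \<le> hom X (L b) (F c b')" by (simp add: mult.commute)
  qed
  then have LP: "restrict L (obj B) \<in> obj P" (is "?L \<in> _")
    using L by (auto simp: vfun_simps vfunctor_def)
  have hPL: "hom P \<kappa> ?L = (INF c\<in>obj C. w c \<leadsto> hom P \<kappa> (F c))" if \<kappa>: "\<kappa> \<in> obj P" for \<kappa>
  proof -
    have "hom P \<kappa> ?L = (INF b\<in>obj B. INF c\<in>obj C. w c \<leadsto> hom X (\<kappa> b) (F c b))"
      unfolding hom_P using hL P_obj[OF \<kappa>] by (intro INF_cong) auto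
    also have "\<dots> = (INF c\<in>obj C. INF b\<in>obj B. w c \<leadsto> hom X (\<kappa> b) (F c b))"
      by (rule INF_commute)
    also have "\<dots> = (INF c\<in>obj C. w c \<leadsto> hom P \<kappa> (F c))"
      unfolding hom_P by (simp add: quantale_imp_INF)
    finally show ?thesis .
  qed
  have "hom P (lo (up ?L)) ?L = hom P ?L ?L"
    using K_reflection[OF LP F_K] hPL[OF LP] hPL[OF lo_in_Q_P[OF up_in_P_Q[OF LP]]]
    by (simp cong: INF_cong)
  then have "?L \<in> obj K\<psi>" using LP vcat_refl[OF P LP] by (simp add: K_iff)
  then obtain i where i: "i \<in> obj C" and iso: "viso P (F i) ?L" using F_eso by blast
  have "hom C c i = (INF d\<in>obj C. w d \<leadsto> hom C c d)" if c: "c \<in> obj C" for c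
  proof -
    have "hom C c i = hom P (F c) ?L"
      using F_ff[OF c i] viso_hom_right[OF P iso F_P[OF i] LP F_P[OF c]] by simp
    also have "\<dots> = (INF d\<in>obj C. w d \<leadsto> hom C c d)"
      unfolding hPL[OF F_P[OF c]] using F_ff[OF c] by (intro INF_cong) auto
    finally show ?thesis .
  qed
  then show "\<exists>i. is_vinf C w i" using i by (auto simp: is_vinf_def)
qed

text \<open>The witness \<open>e\<close> corresponds to the reflection of the functor freely generated by \<open>x\<close> at \<open>b\<close>.\<close>

lemma ex_beta_object:
  assumes b: "b \<in> obj B" and x: "x \<in> obj X"
  shows "\<exists>e\<in>obj C. \<forall>c\<in>obj C. hom C e c = hom X x (F c b)"
proof -
  obtain \<kappa> where \<kappa>: "\<kappa> \<in> obj P" and h\<kappa>: "\<And>\<nu>. \<nu> \<in> obj P \<Longrightarrow> hom P \<kappa> \<nu> = hom X x (\<nu> b)"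
    using ex_free_functor[OF b x] by blast
  note cl = lo_in_K[OF up_in_P_Q[OF \<kappa>]]
  obtain e where e: "e \<in> obj C" and iso: "viso P (F e) (lo (up \<kappa>))"
    using F_eso[OF cl] by blast
  have "hom C e c = hom X x (F c b)" if c: "c \<in> obj C" for c
  proof -
    have "hom C e c = hom P (lo (up \<kappa>)) (F c)"
      using F_ff[OF e c] viso_hom_left[OF P iso F_P[OF e] _ F_P[OF c]] cl by (simp add: K_simps)
    also have "\<dots> = hom X x (F c b)"
      using K_reflection[OF \<kappa> F_K[OF c]] h\<kappa>[OF F_P[OF c]] by simp
    finally show ?thesis .
  qed
  then show ?thesis using e by blast
qed

text \<open>The witness \<open>e\<close> corresponds to \<open>lo\<close> of the functor cofreely generated by \<open>z\<close> at \<open>a\<close>.  The second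
  conjunct is what becomes the formula for \<open>C(\<beta>(b, x), \<alpha>(a, z))\<close>.\<close>

lemma ex_alpha_object:
  assumes a: "a \<in> obj A" and z: "z \<in> obj Z"
  shows "\<exists>e\<in>obj C. (\<forall>c\<in>obj C. hom C c e = hom Z (up (F c) a) z) \<and>
    (\<forall>b\<in>obj B. \<forall>x\<in>obj X. hom X x (F e b) = hom Y (\<psi> (a, b)) (r (x, z)))"
proof -
  obtain \<kappa> where \<kappa>: "\<kappa> \<in> obj Q" and h\<kappa>: "\<And>\<mu>. \<mu> \<in> obj Q \<Longrightarrow> hom Q \<mu> \<kappa> = hom Z (\<mu> a) z"
    using ex_cofree_functor[OF a z] by blast
  obtain e where e: "e \<in> obj C" and iso: "viso P (F e) (lo \<kappa>)"
    using F_eso[OF lo_in_K[OF \<kappa>]] by blast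
  have P_e: "hom P \<nu> (F e) = hom Z (up \<nu> a) z" if \<nu>: "\<nu> \<in> obj P" for \<nu>
    using viso_hom_right[OF P iso F_P[OF e] lo_in_Q_P[OF \<kappa>] \<nu>] up_lo_adjoint[OF \<nu> \<kappa>]
      h\<kappa>[OF up_in_P_Q[OF \<nu>]] by simp
  have "hom X x (F e b) = hom Y (\<psi> (a, b)) (r (x, z))" if b: "b \<in> obj B" and x: "x \<in> obj X" for b x
  proof -
    \<comment> \<open>In fact \<open>F e\<close> is isomorphic to \<open>b' \<mapsto> z \<swarrow> \<psi>(a, b')\<close>: both represent \<open>\<nu> \<mapsto> Z(up \<nu> a, z)\<close>.
      Homs out of the functor \<open>\<phi>\<close> freely generated by \<open>x\<close> at \<open>b\<close> compare their values at \<open>b\<close>.\<close>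
    obtain \<phi> where \<phi>: "\<phi> \<in> obj P" and h\<phi>: "\<And>\<nu>. \<nu> \<in> obj P \<Longrightarrow> hom P \<phi> \<nu> = hom X x (\<nu> b)"
      using ex_free_functor[OF b x] by blast
    have lP: "(\<lambda>b'\<in>obj B. l (z, \<psi> (a, b'))) \<in> obj P" (is "?l \<in> _")
      using l_obj[OF z \<psi>_obj[OF a]]
        order.trans[OF \<psi>_hom_right[OF a] l_hom_right[OF z \<psi>_obj[OF a] \<psi>_obj[OF a]]]
      by (auto simp: vfun_simps vfunctor_def)
    have "hom X x (F e b) = hom Z (up \<phi> a) z" using h\<phi>[OF F_P[OF e]] P_e[OF \<phi>] by simp
    also have "\<dots> = hom P \<phi> ?l"
      unfolding up_hom(2)[OF \<phi> a z] hom_P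
      using hom_t[OF P_obj[OF \<phi>] \<psi>_obj[OF a] z] by (intro INF_cong) auto
    also have "\<dots> = hom Y (\<psi> (a, b)) (r (x, z))"
      using h\<phi>[OF lP] hom_r[OF x \<psi>_obj[OF a b] z] b by simp
    finally show ?thesis .
  qed
  then show ?thesis using e F_ff[OF _ e] P_e[OF F_P] by auto
qed

lemma ex_dense_codense_if_ff_eso:
  "\<exists>\<beta> \<alpha>. vdense (B \<otimes>\<^sub>V X) C \<beta> \<and> vcodense (A \<otimes>\<^sub>V Z) C \<alpha> \<and>
      (\<forall>a\<in>obj A. \<forall>b\<in>obj B. \<forall>x\<in>obj X. \<forall>z\<in>obj Z.
        hom C (\<beta> (b, x)) (\<alpha> (a, z)) = hom Y (\<psi> (a, b)) (r (x, z)))"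
proof -
  have "\<forall>p\<in>obj B \<times> obj X. \<exists>e\<in>obj C. \<forall>c\<in>obj C. hom C e c = hom X (snd p) (F c (fst p))"
    using ex_beta_object by auto
  from bchoice[OF this[unfolded Bex_def]] obtain \<beta> where \<beta>0: "\<forall>p\<in>obj B \<times> obj X. \<beta> p \<in> obj C \<and>
      (\<forall>c\<in>obj C. hom C (\<beta> p) c = hom X (snd p) (F c (fst p)))"
    by blast
  have \<beta>: "\<beta> (b, x) \<in> obj C" if "b \<in> obj B" "x \<in> obj X" for b x
    using \<beta>0 that by auto
  have h\<beta>: "hom C (\<beta> (b, x)) c = hom X x (F c b)"
    if "b \<in> obj B" "x \<in> obj X" "c \<in> obj C" for b x c
    using \<beta>0 that by auto
  have "\<forall>p\<in>obj A \<times> obj Z. \<exists>e\<in>obj C. (\<forall>c\<in>obj C. hom C c e = hom Z (up (F c) (fst p)) (snd p)) \<and>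
    (\<forall>b\<in>obj B. \<forall>x\<in>obj X. hom X x (F e b) = hom Y (\<psi> (fst p, b)) (r (x, snd p)))"
    using ex_alpha_object by auto
  from bchoice[OF this[unfolded Bex_def]] obtain \<alpha> where \<alpha>0: "\<forall>p\<in>obj A \<times> obj Z. \<alpha> p \<in> obj C \<and>
      (\<forall>c\<in>obj C. hom C c (\<alpha> p) = hom Z (up (F c) (fst p)) (snd p)) \<and>
      (\<forall>b\<in>obj B. \<forall>x\<in>obj X. hom X x (F (\<alpha> p) b) = hom Y (\<psi> (fst p, b)) (r (x, snd p)))"
    by blast
  have \<alpha>: "\<alpha> (a, z) \<in> obj C" if "a \<in> obj A" "z \<in> obj Z" for a z
    using \<alpha>0 that by auto
  have h\<alpha>: "hom C c (\<alpha> (a, z)) = hom Z (up (F c) a) z"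
    if "a \<in> obj A" "z \<in> obj Z" "c \<in> obj C" for a z c
    using \<alpha>0 that by auto
  have F\<alpha>: "hom X x (F (\<alpha> (a, z)) b) = hom Y (\<psi> (a, b)) (r (x, z))"
    if "a \<in> obj A" "z \<in> obj Z" "b \<in> obj B" "x \<in> obj X" for a z b x
    using \<alpha>0 that by auto
  have "hom B b b' * hom X x x' \<le> hom C (\<beta> (b, x)) (\<beta> (b', x'))"
    if b: "b \<in> obj B" "b' \<in> obj B" and x: "x \<in> obj X" "x' \<in> obj X" for b b' x x'
  proof -
    note c = \<beta>[OF b(2) x(2)] and Fo = P_obj[OF F_P[OF \<beta>[OF b(2) x(2)]]]
    have "1 \<le> hom X x' (F (\<beta> (b', x')) b')"
      using vcat_refl[OF C c] h\<beta>[OF b(2) x(2) c] by simp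
    then have "hom X x x' \<le> hom X x (F (\<beta> (b', x')) b')"
      using hom_mono_right[OF X(1)] x Fo b by blast
    moreover have "hom B b b' \<le> hom X (F (\<beta> (b', x')) b') (F (\<beta> (b', x')) b)"
      using P_hom[OF F_P[OF c]] b by blast
    ultimately have "hom X x x' * hom B b b' \<le>
        hom X x (F (\<beta> (b', x')) b') * hom X (F (\<beta> (b', x')) b') (F (\<beta> (b', x')) b)"
      by (rule quantale_mult_mono2)
    also have "\<dots> \<le> hom X x (F (\<beta> (b', x')) b)" using vcat_comp[OF X(1)] Fo b x by blast
    finally show ?thesis using h\<beta>[OF b(1) x(1) c] by (simp add: mult.commute)
  qed
  then have \<beta>f: "vfunctor (B \<otimes>\<^sub>V X) C \<beta>" using \<beta> by (auto simp: vfunctor_def)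
  have "hom A a a' * hom Z z z' \<le> hom C (\<alpha> (a, z)) (\<alpha> (a', z'))"
    if a: "a \<in> obj A" "a' \<in> obj A" and z: "z \<in> obj Z" "z' \<in> obj Z" for a a' z z'
  proof -
    note c = \<alpha>[OF a(1) z(1)]
    note G = up_in_P_Q[OF F_P[OF c]]
    note Go = Q_obj[OF G]
    have "1 \<le> hom Z (up (F (\<alpha> (a, z))) a) z"
      using vcat_refl[OF C c] h\<alpha>[OF a(1) z(1) c] by simp
    then have "hom Z z z' \<le> hom Z (up (F (\<alpha> (a, z))) a) z'"
      using hom_mono_left[OF Z(1)] z Go a by blast
    moreover have "hom A a a' \<le> hom Z (up (F (\<alpha> (a, z))) a') (up (F (\<alpha> (a, z))) a)"
      using Q_hom[OF G] a by blast
    ultimately have "hom A a a' * hom Z z z' \<le>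
        hom Z (up (F (\<alpha> (a, z))) a') (up (F (\<alpha> (a, z))) a) * hom Z (up (F (\<alpha> (a, z))) a) z'"
      by (intro quantale_mult_mono2)
    also have "\<dots> \<le> hom Z (up (F (\<alpha> (a, z))) a') z'" using vcat_comp[OF Z(1)] Go a z by blast
    finally show ?thesis using h\<alpha>[OF a(2) z(2) c] by simp
  qed
  then have \<alpha>f: "vfunctor (A \<otimes>\<^sub>V Z) C \<alpha>" using \<alpha> by (auto simp: vfunctor_def)
  have "hom C c d = (INF p\<in>obj B \<times> obj X. hom C (\<beta> p) c \<leadsto> hom C (\<beta> p) d)"
    if c: "c \<in> obj C" and d: "d \<in> obj C" for c d
  proof -
    have "hom C c d = (INF b\<in>obj B. hom X (F c b) (F d b))"
      using F_ff[OF c d] by (simp add: hom_P)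
    also have "\<dots> = (INF b\<in>obj B. INF x\<in>obj X. hom X x (F c b) \<leadsto> hom X x (F d b))"
      using hom_yoneda_in[OF X(1)] P_obj[OF F_P[OF c]] P_obj[OF F_P[OF d]]
      by (intro INF_cong) auto
    also have "\<dots> = (INF p\<in>obj B \<times> obj X. hom C (\<beta> p) c \<leadsto> hom C (\<beta> p) d)"
      unfolding INF_Times using h\<beta> c d by (intro INF_cong) auto
    finally show ?thesis .
  qed
  then have "vdense (B \<otimes>\<^sub>V X) C \<beta>" using \<beta>f by (simp add: vdense_iff_canonical[OF C])
  moreover have "hom C d c = (INF p\<in>obj A \<times> obj Z. hom C c (\<alpha> p) \<leadsto> hom C d (\<alpha> p))"
    if c: "c \<in> obj C" and d: "d \<in> obj C" for c d
  proof -
    have "hom C d c = (INF a\<in>obj A. hom Z (up (F d) a) (up (F c) a))"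
      using F_ff[OF d c] hom_P_eq_hom_Q[OF F_P[OF d] F_K[OF c]] by (simp add: hom_Q)
    also have "\<dots> = (INF a\<in>obj A. INF z\<in>obj Z. hom Z (up (F c) a) z \<leadsto> hom Z (up (F d) a) z)"
      using hom_yoneda_out[OF Z(1)] up_hom(1)[OF F_P[OF c]] up_hom(1)[OF F_P[OF d]]
      by (intro INF_cong) auto
    also have "\<dots> = (INF p\<in>obj A \<times> obj Z. hom C c (\<alpha> p) \<leadsto> hom C d (\<alpha> p))"
      unfolding INF_Times using h\<alpha> c d by (intro INF_cong) auto
    finally show ?thesis .
  qed
  then have "vcodense (A \<otimes>\<^sub>V Z) C \<alpha>" using \<alpha>f by (simp add: vcodense_iff_canonical[OF C])
  moreover have "hom C (\<beta> (b, x)) (\<alpha> (a, z)) = hom Y (\<psi> (a, b)) (r (x, z))"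
    if "a \<in> obj A" "b \<in> obj B" "x \<in> obj X" "z \<in> obj Z" for a b x z
    using h\<beta> \<alpha> F\<alpha> that by simp
  ultimately show ?thesis by blast
qed

end

section \<open>Building the equivalence from the bifunctors\<close>

context
  fixes C :: "('c, 'v) vcat" and \<beta> :: "'b \<times> 'x \<Rightarrow> 'c" and \<alpha> :: "'a \<times> 'z \<Rightarrow> 'c"
  assumes C: "vcategory C" "vcomplete C"
    and dense: "vdense (B \<otimes>\<^sub>V X) C \<beta>" and codense: "vcodense (A \<otimes>\<^sub>V Z) C \<alpha>"
    and \<beta>\<alpha>: "\<And>a b x z. a \<in> obj A \<Longrightarrow> b \<in> obj B \<Longrightarrow> x \<in> obj X \<Longrightarrow> z \<in> obj Z \<Longrightarrow>
        hom C (\<beta> (b, x)) (\<alpha> (a, z)) = hom Y (\<psi> (a, b)) (r (x, z))"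
begin

lemma \<beta>_functor: "vfunctor (B \<otimes>\<^sub>V X) C \<beta>"
  using dense by (simp add: vdense_def)

lemma \<beta>_obj: "b \<in> obj B \<Longrightarrow> x \<in> obj X \<Longrightarrow> \<beta> (b, x) \<in> obj C"
  using vfunctor_obj[OF \<beta>_functor, of "(b, x)"] by simp

lemma \<alpha>_obj: "a \<in> obj A \<Longrightarrow> z \<in> obj Z \<Longrightarrow> \<alpha> (a, z) \<in> obj C"
  using codense vfunctor_obj[of "A \<otimes>\<^sub>V Z" C \<alpha> "(a, z)"] by (simp add: vcodense_def)

lemma \<beta>_hom_left:
  assumes b: "b \<in> obj B" "b' \<in> obj B" and x: "x \<in> obj X"
  shows "hom B b b' \<le> hom C (\<beta> (b, x)) (\<beta> (b', x))"
proof -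
  have "hom B b b' * 1 \<le> hom B b b' * hom X x x"
    using vcat_refl[OF X(1) x] by (rule quantale_mult_mono)
  then show ?thesis using vfunctor_hom[OF \<beta>_functor, of "(b, x)" "(b', x)"] b x by simp
qed

lemma hom_C_via_\<beta>:
  assumes "c \<in> obj C" "d \<in> obj C"
  shows "hom C c d = (INF b\<in>obj B. INF x\<in>obj X. hom C (\<beta> (b, x)) c \<leadsto> hom C (\<beta> (b, x)) d)"
  using dense assms by (simp add: vdense_iff_canonical[OF C(1)] INF_Times)

lemma hom_C_via_\<alpha>:
  assumes "c \<in> obj C" "d \<in> obj C"
  shows "hom C d c = (INF a\<in>obj A. INF z\<in>obj Z. hom C c (\<alpha> (a, z)) \<leadsto> hom C d (\<alpha> (a, z)))"
  using codense assms by (simp add: vcodense_iff_canonical[OF C(1)] INF_Times)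

lemma hom_\<beta>_\<alpha>:
  assumes "a \<in> obj A" "b \<in> obj B" "x \<in> obj X" "z \<in> obj Z"
  shows "hom C (\<beta> (b, x)) (\<alpha> (a, z)) = hom X x (l (z, \<psi> (a, b)))"
    and "hom C (\<beta> (b, x)) (\<alpha> (a, z)) = hom Z (t (x, \<psi> (a, b))) z"
  using \<beta>\<alpha>[OF assms] hom_r[OF assms(3) \<psi>_obj assms(4)] hom_t[OF assms(3) \<psi>_obj assms(4)] assms
  by auto

text \<open>Each \<open>\<beta> (b, -)\<close> has a right adjoint: \<open>c\<close> is a limit of objects \<open>\<alpha> (a, z)\<close>, at which
  representability holds by \<open>hom_\<beta>_\<alpha>\<close>, and \<open>X\<close> has the corresponding limits.\<close>

lemma ex_representing_functor:
  assumes c: "c \<in> obj C"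
  shows "\<exists>\<nu>\<in>obj P. \<forall>b\<in>obj B. \<forall>x\<in>obj X. hom X x (\<nu> b) = hom C (\<beta> (b, x)) c"
proof -
  have "\<exists>i. i \<in> obj X \<and> (\<forall>x\<in>obj X. hom X x i = hom C (\<beta> (b, x)) c)" if b: "b \<in> obj B" for b
  proof -
    have "l (snd p, \<psi> (fst p, b)) \<in> obj X" if "p \<in> obj A \<times> obj Z" for p
      using that l_obj \<psi>_obj b by auto
    from ex_weighted_limit[OF X, of "obj A \<times> obj Z" "\<lambda>p. l (snd p, \<psi> (fst p, b))", OF this, where w = "\<lambda>p. hom C c (\<alpha> p)"]
    obtain i where i: "i \<in> obj X" and hi: "\<And>x. x \<in> obj X \<Longrightarrow>
        hom X x i = (INF p\<in>obj A \<times> obj Z. hom C c (\<alpha> p) \<leadsto> hom X x (l (snd p, \<psi> (fst p, b))))"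
      by auto
    have "hom X x i = hom C (\<beta> (b, x)) c" if x: "x \<in> obj X" for x
      unfolding hi[OF x] INF_Times hom_C_via_\<alpha>[OF c \<beta>_obj[OF b x]]
      using hom_\<beta>_\<alpha>(1)[OF _ b x] by (simp cong: INF_cong)
    then show ?thesis using i by blast
  qed
  then obtain N where N: "\<And>b. b \<in> obj B \<Longrightarrow> N b \<in> obj X"
    and hN: "\<And>b x. b \<in> obj B \<Longrightarrow> x \<in> obj X \<Longrightarrow> hom X x (N b) = hom C (\<beta> (b, x)) c"
    by metis
  have "hom B b' b \<le> hom X (N b) (N b')" if b: "b \<in> obj B" "b' \<in> obj B" for b b'
  proof -
    note Nb = N[OF b(1)]
    have "1 \<le> hom C (\<beta> (b, N b)) c" using vcat_refl[OF X(1) Nb] hN[OF b(1) Nb] by simp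
    then have "hom C (\<beta> (b', N b)) (\<beta> (b, N b)) \<le> hom C (\<beta> (b', N b)) c"
      using hom_mono_right[OF C(1)] \<beta>_obj Nb b c by blast
    then show ?thesis
      using \<beta>_hom_left[OF b(2,1) Nb] hN[OF b(2) Nb] by simp
  qed
  then have "restrict N (obj B) \<in> obj P"
    using N by (auto simp: vfun_simps vfunctor_def)
  then show ?thesis using hN by (intro bexI[of _ "restrict N (obj B)"]) auto
qed

text \<open>The map \<open>F\<close> of representing functors is fully faithful by density of \<open>\<beta>\<close>.  A fixed point \<open>\<nu>\<close> is
  reached from the join \<open>c\<close> of the \<open>\<beta> (b, \<nu> b)\<close>, which by Yoneda is the colimit of all \<open>\<beta> (b, x)\<close>
  weighted by \<open>X(x, \<nu> b)\<close>.\<close>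

lemma vequivalent_if_dense_codense: "vequivalent C K\<psi>"
proof -
  obtain F where FP: "\<And>c. c \<in> obj C \<Longrightarrow> F c \<in> obj P"
    and hF: "\<And>c b x. c \<in> obj C \<Longrightarrow> b \<in> obj B \<Longrightarrow> x \<in> obj X \<Longrightarrow>
      hom X x (F c b) = hom C (\<beta> (b, x)) c"
    using ex_representing_functor by metis
  have ff: "hom P (F c) (F d) = hom C c d" if c: "c \<in> obj C" and d: "d \<in> obj C" for c d
  proof -
    have "hom P (F c) (F d) = (INF b\<in>obj B. INF x\<in>obj X. hom X x (F c b) \<leadsto> hom X x (F d b))"
      unfolding hom_P using hom_yoneda_in[OF X(1)] P_obj[OF FP[OF c]] P_obj[OF FP[OF d]]
      by (intro INF_cong) auto
    also have "\<dots> = hom C c d"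
      unfolding hom_C_via_\<beta>[OF c d] using hF c d by (intro INF_cong) auto
    finally show ?thesis .
  qed
  have upF: "hom Z (up (F c) a) z = hom C c (\<alpha> (a, z))"
    if c: "c \<in> obj C" and a: "a \<in> obj A" and z: "z \<in> obj Z" for c a z
  proof -
    have "hom Z (up (F c) a) z = (INF b\<in>obj B. hom X (F c b) (l (z, \<psi> (a, b))))"
      unfolding up_hom(2)[OF FP[OF c] a z]
      using hom_t[OF P_obj[OF FP[OF c]] \<psi>_obj[OF a] z] by (intro INF_cong) auto
    also have "\<dots> = (INF b\<in>obj B. INF x\<in>obj X. hom X x (F c b) \<leadsto> hom X x (l (z, \<psi> (a, b))))"
      using hom_yoneda_in[OF X(1) P_obj[OF FP[OF c]] l_obj[OF z \<psi>_obj[OF a]]]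
      by (intro INF_cong) auto
    also have "\<dots> = hom C c (\<alpha> (a, z))"
      unfolding hom_C_via_\<beta>[OF c \<alpha>_obj[OF a z]] using hF[OF c] hom_\<beta>_\<alpha>(1)[OF a _ _ z]
      by (intro INF_cong) auto
    finally show ?thesis .
  qed
  \<comment> \<open>By codensity, the closure of any \<open>\<nu>\<close> whose \<open>up\<close> represents \<open>C(c, \<alpha>(a, -))\<close> represents \<open>C(\<beta>(b, -), c)\<close>;
    this is used for \<open>\<nu> = F c\<close> and again for essential surjectivity.\<close>
  have closure: "hom X x (lo (up \<nu>) b) = hom C (\<beta> (b, x)) c"
    if \<nu>: "\<nu> \<in> obj P" and c: "c \<in> obj C"
      and rep: "\<And>a z. a \<in> obj A \<Longrightarrow> z \<in> obj Z \<Longrightarrow> hom Z (up \<nu> a) z = hom C c (\<alpha> (a, z))"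
      and b: "b \<in> obj B" and x: "x \<in> obj X" for \<nu> c b x
  proof -
    have "hom X x (lo (up \<nu>) b) = (INF a\<in>obj A. hom Z (t (x, \<psi> (a, b))) (up \<nu> a))"
      unfolding lo_hom(2)[OF up_in_P_Q[OF \<nu>] b x]
      using hom_t[OF x \<psi>_obj[OF _ b] up_hom(1)[OF \<nu>]] by (intro INF_cong) auto
    also have "\<dots> = (INF a\<in>obj A. INF z\<in>obj Z. hom Z (up \<nu> a) z \<leadsto> hom Z (t (x, \<psi> (a, b))) z)"
      using hom_yoneda_out[OF Z(1) t_obj[OF x \<psi>_obj[OF _ b]] up_hom(1)[OF \<nu>]]
      by (intro INF_cong) auto
    also have "\<dots> = hom C (\<beta> (b, x)) c"
      unfolding hom_C_via_\<alpha>[OF c \<beta>_obj[OF b x]] using rep hom_\<beta>_\<alpha>(2)[OF _ b x]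
      by (intro INF_cong) auto
    finally show ?thesis .
  qed
  have iso: "viso P (lo (up \<nu>)) (F c)"
    if \<nu>: "\<nu> \<in> obj P" and c: "c \<in> obj C"
      and rep: "\<And>a z. a \<in> obj A \<Longrightarrow> z \<in> obj Z \<Longrightarrow> hom Z (up \<nu> a) z = hom C c (\<alpha> (a, z))" for \<nu> c
  proof (rule viso_vfun_if_pointwise)
    fix b assume "b \<in> obj (vop B)"
    then have b: "b \<in> obj B" by simp
    show "viso X (lo (up \<nu>) b) (F c b)"
      using closure[OF \<nu> c rep b] hF[OF c b] lo_hom(1)[OF up_in_P_Q[OF \<nu>] b] P_obj[OF FP[OF c] b]
      by (intro viso_if_hom_into_eq[OF X(1)]) auto
  qed
  have "F c \<in> obj K\<psi>" if "c \<in> obj C" for c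
    using iso[OF FP that upF] FP that by (simp add: K_simps)
  moreover have "\<exists>c\<in>obj C. viso P (F c) \<nu>" if \<nu>K: "\<nu> \<in> obj K\<psi>" for \<nu>
  proof -
    have \<nu>: "\<nu> \<in> obj P" and cl: "viso P (lo (up \<nu>)) \<nu>" using \<nu>K by (auto simp: K_simps)
    obtain c where c: "c \<in> obj C"
      and hc: "\<And>d. d \<in> obj C \<Longrightarrow> hom C c d = (INF b\<in>obj B. hom C (\<beta> (b, \<nu> b)) d)"
      using ex_weighted_colimit[OF C, of "obj B" "\<lambda>b. \<beta> (b, \<nu> b)" "\<lambda>_. 1"] \<beta>_obj P_obj[OF \<nu>] by auto
    have "hom Z (up \<nu> a) z = hom C c (\<alpha> (a, z))" if a: "a \<in> obj A" and z: "z \<in> obj Z" for a z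
      unfolding up_hom(2)[OF \<nu> a z] hc[OF \<alpha>_obj[OF a z]]
      using hom_\<beta>_\<alpha>(2)[OF a _ P_obj[OF \<nu>] z] by (intro INF_cong) auto
    then have "viso P (lo (up \<nu>)) (F c)" by (rule iso[OF \<nu> c])
    then have "viso P (F c) \<nu>"
      using viso_trans[OF P viso_sym cl FP[OF c] lo_in_Q_P[OF up_in_P_Q[OF \<nu>]] \<nu>] by blast
    then show ?thesis using c by blast
  qed
  ultimately show ?thesis
    unfolding vequivalent_iff_ff_eso[OF C(1) vcategory_K] viso_K K_simps(2)
    using ff by (intro exI[of _ F]) auto
qed

end

end

theorem corollary6p6:
  fixes X :: "('x, 'v::comm_quantale) vcat"
    and Y :: "('y, 'v) vcat"
    and Z :: "('z, 'v) vcat"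
    and A :: "('a, 'v) vcat"
    and B :: "('b, 'v) vcat"
    and C :: "('c, 'v) vcat"
    and t :: "'x \<times> 'y \<Rightarrow> 'z"
    and l :: "'z \<times> 'y \<Rightarrow> 'x"
    and r :: "'x \<times> 'z \<Rightarrow> 'y"
    and \<psi> :: "'a \<times> 'b \<Rightarrow> 'y"
  assumes "vcategory X" and "vcomplete X"
    and "vcategory Y" and "vcomplete Y"
    and "vcategory Z" and "vcomplete Z"
    and "two_var_adjunction X Y Z t l r"
    and "vcategory A" and "vcategory B"
    and "vfunctor (vop A \<otimes>\<^sub>V B) Y \<psi>"
    and "vcategory C"
  shows "vequivalent C (K t l X Z A B \<psi>) \<longleftrightarrow>
    vcomplete C \<and>
    (\<exists>\<beta> \<alpha>. vdense (B \<otimes>\<^sub>V X) C \<beta> \<and> vcodense (A \<otimes>\<^sub>V Z) C \<alpha> \<and>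
      (\<forall>a\<in>obj A. \<forall>b\<in>obj B. \<forall>x\<in>obj X. \<forall>z\<in>obj Z.
        hom C (\<beta> (b, x)) (\<alpha> (a, z)) = hom Y (\<psi> (a, b)) (r (x, z))))"
proof -
  interpret isbell_adjunction X Y Z A B t l r \<psi>
    using assms by unfold_locales
  show ?thesis
  proof
    assume "vequivalent C (K t l X Z A B \<psi>)"
    then obtain F where F: "F \<in> obj C \<rightarrow> obj K\<psi>"
      and ff: "\<And>c d. c \<in> obj C \<Longrightarrow> d \<in> obj C \<Longrightarrow> hom P (F c) (F d) = hom C c d"
      and eso: "\<And>\<nu>. \<nu> \<in> obj K\<psi> \<Longrightarrow> \<exists>c\<in>obj C. viso P (F c) \<nu>"
      unfolding vequivalent_iff_ff_eso[OF assms(11) vcategory_K] viso_K K_simps(2) by blast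
    have FK: "\<And>c. c \<in> obj C \<Longrightarrow> F c \<in> obj K\<psi>" using F by blast
    from vcomplete_if_ff_eso[OF assms(11) FK ff eso]
      ex_dense_codense_if_ff_eso[OF assms(11) FK ff eso]
    show "vcomplete C \<and>
      (\<exists>\<beta> \<alpha>. vdense (B \<otimes>\<^sub>V X) C \<beta> \<and> vcodense (A \<otimes>\<^sub>V Z) C \<alpha> \<and>
        (\<forall>a\<in>obj A. \<forall>b\<in>obj B. \<forall>x\<in>obj X. \<forall>z\<in>obj Z.
          hom C (\<beta> (b, x)) (\<alpha> (a, z)) = hom Y (\<psi> (a, b)) (r (x, z))))"
      by blast
  next
    assume "vcomplete C \<and>
      (\<exists>\<beta> \<alpha>. vdense (B \<otimes>\<^sub>V X) C \<beta> \<and> vcodense (A \<otimes>\<^sub>V Z) C \<alpha> \<and>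
        (\<forall>a\<in>obj A. \<forall>b\<in>obj B. \<forall>x\<in>obj X. \<forall>z\<in>obj Z.
          hom C (\<beta> (b, x)) (\<alpha> (a, z)) = hom Y (\<psi> (a, b)) (r (x, z))))"
    then show "vequivalent C (K t l X Z A B \<psi>)"
      using vequivalent_if_dense_codense[OF assms(11)] by blast
  qed
qed

end
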